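(* Suppose $A,B$ are positive matrices over $\mathbb R$ which are strong shift equivalent over $\mathbb R_+$. Then $A,B$ are strong shift equivalent over $\mathbb R_+$ through positive matrices: there are positive matrices $A=A_0,A_1,\dots,A_\ell=B$, with $A_i$ elementary strong shift equivalent over $\mathbb R_+$ to $A_{i+1}$ for $0\le i<\ell$.
   Context: A matrix is positive if all its entries are positive. All matrices $A_i$ are square, possibly of different sizes. $\mathbb R_+=[0,\infty)$. Square matrices $A,B$ are elementary strong shift equivalent over a semiring $\mathcal S$ if there are (possibly rectangular) matrices $R,S$ over $\mathcal S$ with $A=RS$ and $B=SR$. They are strong shift equivalent over $\mathcal S$ if they are connected by a finite chain of square matrices over $\mathcal S$ in which consecutive matrices are elementary strong shift equivalent over $\mathcal S$. *)

theory Defs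
  imports Jordan_Normal_Form.Matrix
begin

text \<open>
  No lower bound is imposed on dimensions, so the empty matrix is vacuously positive.
  This adds nothing essential: elementary strong shift equivalence over
  \<open>\<real>\<^sub>+\<close> preserves the trace, so
  no chain connects the empty matrix to a positive matrix of size at least 1.
\<close>

definition positive_mat :: "real mat \<Rightarrow> bool" where
  "positive_mat M \<longleftrightarrow> (\<forall>i<dim_row M. \<forall>j<dim_col M. 0 < M $$ (i, j))"

text \<open>
  A semiring is given by a carrier set \<open>S\<close> inside an ambient type, so that \<open>\<real>\<^sub>+\<close> is
  \<open>{0..} :: real set\<close>. The operations are those of the type; closure of \<open>S\<close> under them
  is not part of the definitions.
\<close>

definition elementary_sse :: "'a::semiring_0 set \<Rightarrow> 'a mat \<Rightarrow> 'a mat \<Rightarrow> bool" where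
  "elementary_sse S A B \<longleftrightarrow>
     (\<exists>m n. \<exists>U \<in> carrier_mat m n. \<exists>V \<in> carrier_mat n m.
        elements_mat U \<subseteq> S \<and> elements_mat V \<subseteq> S \<and> A = U * V \<and> B = V * U)"

definition strong_shift_equivalent :: "'a::semiring_0 set \<Rightarrow> 'a mat \<Rightarrow> 'a mat \<Rightarrow> bool" where
  "strong_shift_equivalent S A B \<longleftrightarrow>
     (\<exists>(l::nat) M. M 0 = A \<and> M l = B \<and>
        (\<forall>i\<le>l. square_mat (M i) \<and> elements_mat (M i) \<subseteq> S) \<and>
        (\<forall>i<l. elementary_sse S (M i) (M (Suc i))))"

end

theory Submission
  imports "HOL-Analysis.Homotopy" "Jordan_Normal_Form.Determinant" Defs
begin

text \<open>
  Conjugation makes a pair \<open>A = R S\<close>, \<open>B = S R\<close> positive: if \<open>X\<close> and \<open>Y\<close> are matrices with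
  \<open>X R - R Y > 0\<close> at the zeros of \<open>R\<close> and \<open>Y S - S X > 0\<close> at the zeros of \<open>S\<close>, then for small
  \<open>e > 0\<close> the factors \<open>(1 + e X) R (1 + e Y)\<^sup>-\<^sup>1\<close> and \<open>(1 + e Y) S (1 + e X)\<^sup>-\<^sup>1\<close> are positive,
  and they link \<open>(1 + e X) A (1 + e X)\<^sup>-\<^sup>1\<close> to \<open>(1 + e Y) B (1 + e Y)\<^sup>-\<^sup>1\<close> through positive
  matrices (\<open>eventually_positive_step\<close>).  Such \<open>X\<close> is a direction of \<open>A\<close>: \<open>X A - A X > 0\<close> at the
  zeros of \<open>A\<close>.  Two steps of a chain that meet in \<open>A\<close> provide two directions of \<open>A\<close>; as these form
  an open convex set, the two perturbations of \<open>A\<close> are connected through positive matrices along the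
  segment between them (\<open>directions_positively_connected\<close>).  A positive matrix has the direction
  \<open>0\<close>, so the ends of the chain stay where they are.

  What remains is to find a chain in which every step has such \<open>X\<close> and \<open>Y\<close>.  A theorem of the
  alternative gives a usable criterion (\<open>marked_pair_directions\<close>).  Mark states \<open>a\<close> of \<open>A\<close> and \<open>b\<close>
  of \<open>B\<close> with \<open>R\<^sub>a\<^sub>b > 0\<close> and \<open>S\<^sub>b\<^sub>a > 0\<close>.  Directions exist if every state has a path to the
  mark and every infinite path of \<open>B\<close> meets the support of the row \<open>R\<^sub>a\<close>.  A positive diagonal entry
  of the first matrix propagates to marks all along the chain, and cutting each matrix down to the
  strong component of its mark respects the factorisations (\<open>marked_pair_component\<close>) and does not
  change positive matrices.

  In general only the weaker condition holds that every infinite path of \<open>B\<close> meets the support of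
  \<open>R\<^sub>a B\<^sup>q\<close> for some large \<open>q\<close>.  The delay \<open>q\<close> is brought down to \<open>0\<close> by blow-ups: splitting a
  quarter off the row of the mark yields an equivalent matrix whose marked row sees one step further.
  Blowing up all matrices of the chain replaces each step of delay \<open>q + 1\<close> by three steps of
  delay \<open>q\<close> (\<open>linked_mark_blow_link\<close>).  A positive matrix is connected to its iterated blow-ups by
  steps of delay \<open>0\<close> (\<open>linked_iterated_mark_blow\<close>).  So two positive ends are joined by a chain of
  delay \<open>0\<close> (\<open>linked_0_if_linked\<close>), which is cut down to strong components once more.
\<close>

section \<open>Marked systems and their links\<close>

text \<open>
  Matrices are functions read on finite index sets, since the constructions below add states to a
  system and cut it down to subsets of its states.  The marks \<open>a\<close> and \<open>b\<close> are states that the two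
  factors join in both directions, so that both carry a loop.
\<close>

definition marked_pair ::
  "'i set \<Rightarrow> ('i \<Rightarrow> 'i \<Rightarrow> real) \<Rightarrow> 'i \<Rightarrow> 'k set \<Rightarrow> ('k \<Rightarrow> 'k \<Rightarrow> real) \<Rightarrow> 'k \<Rightarrow>
    ('i \<Rightarrow> 'k \<Rightarrow> real) \<Rightarrow> ('k \<Rightarrow> 'i \<Rightarrow> real) \<Rightarrow> bool" where
  "marked_pair I A a J B b R S \<longleftrightarrow>
     finite I \<and> finite J \<and> a \<in> I \<and> b \<in> J \<and> 0 < R a b \<and> 0 < S b a \<and>
     (\<forall>i\<in>I. \<forall>k\<in>J. 0 \<le> R i k \<and> 0 \<le> S k i) \<and>
     (\<forall>i\<in>I. \<forall>j\<in>I. A i j = (\<Sum>k\<in>J. R i k * S k j)) \<and>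
     (\<forall>k\<in>J. \<forall>l\<in>J. B k l = (\<Sum>i\<in>I. S k i * R i l))"

lemma marked_pair_sym:
  "marked_pair I A a J B b R S \<Longrightarrow> marked_pair J B b I A a S R"
  by (auto simp: marked_pair_def)

lemma marked_pair_edge_iff:
  assumes "marked_pair I A a J B b R S" "i \<in> I" "j \<in> I"
  shows "0 < A i j \<longleftrightarrow> (\<exists>k\<in>J. 0 < R i k \<and> 0 < S k j)"
proof -
  have nn: "\<forall>k\<in>J. 0 \<le> R i k * S k j" and fin: "finite J"
    and A: "A i j = (\<Sum>k\<in>J. R i k * S k j)"
    using assms by (auto simp: marked_pair_def)
  have "0 < A i j \<longleftrightarrow> (\<exists>k\<in>J. R i k * S k j \<noteq> 0)"
    using sum_nonneg_eq_0_iff[OF fin, of "\<lambda>k. R i k * S k j"] nn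
      sum_nonneg[of J "\<lambda>k. R i k * S k j"] by (auto simp: A less_le)
  also have "\<dots> \<longleftrightarrow> (\<exists>k\<in>J. 0 < R i k \<and> 0 < S k j)"
    using assms by (fastforce simp: marked_pair_def less_le)
  finally show ?thesis .
qed

lemma marked_pair_ge_term:
  assumes "marked_pair I A a J B b R S" "i \<in> I" "j \<in> I" "k \<in> J"
  shows "R i k * S k j \<le> A i j"
proof -
  have "R i k * S k j \<le> (\<Sum>k\<in>J. R i k * S k j)"
    using assms by (intro member_le_sum) (auto simp: marked_pair_def)
  then show ?thesis using assms by (auto simp: marked_pair_def)
qed

lemma marked_pair_nonneg:
  assumes "marked_pair I A a J B b R S" "i \<in> I" "j \<in> I"
  shows "0 \<le> A i j"
  using assms by (auto simp: marked_pair_def intro!: sum_nonneg)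

lemma marked_pair_loop:
  assumes "marked_pair I A a J B b R S"
  shows "0 < A a a"
  using marked_pair_edge_iff[OF assms, of a a] assms by (auto simp: marked_pair_def)

text \<open>
  In the pairs built from blow-ups both matrices factor through a third index set \<open>K\<close>, as
  \<open>A = V U\<close> and \<open>B = W T\<close>.  With \<open>U = T S\<close> and \<open>W = S V\<close> they become \<open>(V T) S\<close> and \<open>S (V T)\<close>.
\<close>

lemma marked_pair_through:
  fixes V :: "'p \<Rightarrow> 'k \<Rightarrow> real" and T :: "'k \<Rightarrow> 'n \<Rightarrow> real" and S :: "'n \<Rightarrow> 'p \<Rightarrow> real"
  assumes fin: "finite P" "finite N" "finite K" and marks: "a \<in> P" "b \<in> N"
    and A: "\<And>p p'. p \<in> P \<Longrightarrow> p' \<in> P \<Longrightarrow> A p p' = (\<Sum>k\<in>K. V p k * U k p')"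
    and U: "\<And>k p. k \<in> K \<Longrightarrow> p \<in> P \<Longrightarrow> U k p = (\<Sum>n\<in>N. T k n * S n p)"
    and B: "\<And>n n'. n \<in> N \<Longrightarrow> n' \<in> N \<Longrightarrow> B n n' = (\<Sum>k\<in>K. W n k * T k n')"
    and W: "\<And>n k. n \<in> N \<Longrightarrow> k \<in> K \<Longrightarrow> W n k = (\<Sum>p\<in>P. S n p * V p k)"
    and V0: "\<And>p k. p \<in> P \<Longrightarrow> k \<in> K \<Longrightarrow> 0 \<le> V p k"
    and T0: "\<And>k n. k \<in> K \<Longrightarrow> n \<in> N \<Longrightarrow> 0 \<le> T k n"
    and S0: "\<And>n p. n \<in> N \<Longrightarrow> p \<in> P \<Longrightarrow> 0 \<le> S n p"
    and pos: "0 < (\<Sum>k\<in>K. V a k * T k b)" "0 < S b a"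
  shows "marked_pair P A a N B b (\<lambda>p n. \<Sum>k\<in>K. V p k * T k n) S"
proof -
  have "A p p' = (\<Sum>n\<in>N. (\<Sum>k\<in>K. V p k * T k n) * S n p')" if "p \<in> P" "p' \<in> P" for p p'
  proof -
    have "A p p' = (\<Sum>k\<in>K. V p k * (\<Sum>n\<in>N. T k n * S n p'))"
      using A[OF that] U that by simp
    also have "\<dots> = (\<Sum>n\<in>N. (\<Sum>k\<in>K. V p k * T k n) * S n p')"
      by (simp add: sum_distrib_left sum_distrib_right mult.assoc sum.swap[of _ N K])
    finally show ?thesis .
  qed
  moreover have "B n n' = (\<Sum>p\<in>P. S n p * (\<Sum>k\<in>K. V p k * T k n'))" if "n \<in> N" "n' \<in> N" for n n'
  proof -
    have "B n n' = (\<Sum>k\<in>K. (\<Sum>p\<in>P. S n p * V p k) * T k n')"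
      using B[OF that] W that by simp
    also have "\<dots> = (\<Sum>p\<in>P. S n p * (\<Sum>k\<in>K. V p k * T k n'))"
      by (simp add: sum_distrib_left sum_distrib_right mult.assoc sum.swap[of _ P K])
    finally show ?thesis .
  qed
  ultimately show ?thesis
    using assms by (auto simp: marked_pair_def intro!: sum_nonneg)
qed

primrec hits :: "'k set \<Rightarrow> ('k \<Rightarrow> real) \<Rightarrow> ('k \<Rightarrow> 'k \<Rightarrow> real) \<Rightarrow> nat \<Rightarrow> 'k set" where
  "hits J r B 0 = {k \<in> J. 0 < r k}"
| "hits J r B (Suc q) = {l \<in> J. \<exists>k\<in>hits J r B q. 0 < B k l}"

text \<open>
  The set \<open>hits J r B q\<close> is the support of the row \<open>r B\<^sup>q\<close>.  As \<open>J\<close> is finite, the condition says that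
  the remaining states span no cycle of \<open>B\<close>; infinite paths avoid the bookkeeping for cycles.
\<close>

definition catches :: "'k set \<Rightarrow> ('k \<Rightarrow> real) \<Rightarrow> ('k \<Rightarrow> 'k \<Rightarrow> real) \<Rightarrow> nat \<Rightarrow> bool" where
  "catches J r B q \<longleftrightarrow>
     (\<forall>c::nat \<Rightarrow> 'k. (\<forall>i. c i \<in> J \<and> 0 < B (c i) (c (Suc i))) \<longrightarrow> (\<exists>i. c i \<in> hits J r B q))"

text \<open>A path that has been hit once stays hit, at the same pace.\<close>

lemma hits_along_path:
  assumes path: "\<And>i. c i \<in> J \<and> 0 < B (c i) (c (Suc i))" and "c i \<in> hits J r B m"
  shows "c (i + n) \<in> hits J r B (m + n)"
proof (induction n)
  case 0
  show ?case using assms by simp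
next
  case (Suc n)
  then show ?case using path[of "i + n"] path[of "Suc (i + n)"] by auto
qed

lemma catches_mono:
  assumes "catches J r B m" "m \<le> q"
  shows "catches J r B q"
  unfolding catches_def
proof (intro allI impI)
  fix c :: "nat \<Rightarrow> 'a"
  assume path: "\<forall>i. c i \<in> J \<and> 0 < B (c i) (c (Suc i))"
  then obtain i where "c i \<in> hits J r B m" using assms(1) unfolding catches_def by blast
  then have "c (i + (q - m)) \<in> hits J r B (m + (q - m))"
    using path hits_along_path[of c J B i r m "q - m"] by blast
  then show "\<exists>i. c i \<in> hits J r B q" using assms(2) by auto
qed

text \<open>
  Passing to a larger system gains a step: the row \<open>r'\<close> already sees what \<open>r B\<close> sees.  A new state
  \<open>n\<close> does no harm to the catching property if \<open>r'\<close> sees \<open>n\<close>, or sees everything that \<open>n\<close> sees; in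
  the latter case a path through \<open>n\<close> is met at its next state.
\<close>

lemma catches_extend:
  assumes c: "catches J r B (Suc q)"
    and J': "J' = f ` J \<union> N" and f: "inj_on f J"
    and edge: "\<And>k l. k \<in> J \<Longrightarrow> l \<in> J \<Longrightarrow> 0 < M (f k) (f l) \<longleftrightarrow> 0 < B k l"
    and base: "\<And>k l. k \<in> J \<Longrightarrow> l \<in> J \<Longrightarrow> 0 < r k \<Longrightarrow> 0 < B k l \<Longrightarrow> 0 < r' (f l)"
    and new: "\<And>n. n \<in> N \<Longrightarrow> 0 < r' n \<or> (\<forall>m\<in>J'. 0 < M n m \<longrightarrow> 0 < r' m)"
  shows "catches J' r' M q"
  unfolding catches_def
proof (intro allI impI)
  fix c :: "nat \<Rightarrow> 'b"
  assume path: "\<forall>i. c i \<in> J' \<and> 0 < M (c i) (c (Suc i))"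
  show "\<exists>i. c i \<in> hits J' r' M q"
  proof (cases "\<exists>i. c i \<in> N")
    case True
    then obtain i where "c i \<in> N" by blast
    then have "0 < r' (c i) \<or> 0 < r' (c (Suc i))" using new path by blast
    then obtain j where "c j \<in> hits J' r' M 0" using path by auto
    then have "c (j + q) \<in> hits J' r' M (0 + q)" using path hits_along_path by blast
    then show ?thesis by auto
  next
    case False
    then have "\<forall>i. \<exists>k. k \<in> J \<and> c i = f k" using path J' by blast
    then obtain d where d: "\<And>i. d i \<in> J \<and> c i = f (d i)" by metis
    have "\<forall>i. d i \<in> J \<and> 0 < B (d i) (d (Suc i))" using d path edge by metis
    then obtain i where i: "d i \<in> hits J r B (Suc q)" using c unfolding catches_def by blast
    have lift: "k \<in> hits J r B (Suc m) \<Longrightarrow> f k \<in> hits J' r' M m" for k m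
    proof (induction m arbitrary: k)
      case 0
      then show ?case using base J' by auto
    next
      case (Suc m)
      then obtain l where "l \<in> hits J r B (Suc m)" "0 < B l k" "k \<in> J" by auto
      moreover from this have "l \<in> J" by simp
      ultimately have "f l \<in> hits J' r' M m" "0 < M (f l) (f k)" "f k \<in> J'"
        using Suc.IH[of l] edge J' by auto
      then show ?case by auto
    qed
    then show ?thesis using i d by metis
  qed
qed

type_synonym system = "nat set \<times> (nat \<Rightarrow> nat \<Rightarrow> real) \<times> nat"

definition link :: "nat \<Rightarrow> (system \<times> system) set" where
  "link q = {((I, A, a), (J, B, b)). \<exists>R S. marked_pair I A a J B b R S \<and> catches J (R a) B q}"

lemma link_mono: "p \<le> q \<Longrightarrow> link p \<subseteq> link q"
  by (force simp: link_def intro: catches_mono)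

definition linked :: "nat \<Rightarrow> (system \<times> system) set" where
  "linked q = (link q \<union> (link q)\<inverse>)\<^sup>*"

lemma linked_mono: "p \<le> q \<Longrightarrow> linked p \<subseteq> linked q"
  unfolding linked_def using link_mono[of p q] by (intro rtrancl_mono) blast

lemma link_linked: "(s, t) \<in> link q \<Longrightarrow> (s, t) \<in> linked q"
  unfolding linked_def by blast

lemma linked_sym: "(s, t) \<in> linked q \<Longrightarrow> (t, s) \<in> linked q"
  unfolding linked_def
  by (metis converse_Un converse_converse rtrancl_converseI sup_commute)

lemma linked_trans: "(s, t) \<in> linked q \<Longrightarrow> (t, u) \<in> linked q \<Longrightarrow> (s, u) \<in> linked q"
  unfolding linked_def by simp

section \<open>Blow-ups\<close>

definition ext :: "nat set \<Rightarrow> nat set" where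
  "ext I = insert 0 (Suc ` I)"

lemma finite_ext [simp]: "finite (ext I) \<longleftrightarrow> finite I"
  by (simp add: ext_def finite_image_iff)

lemma ext_mem [simp]: "0 \<in> ext I" "Suc i \<in> ext I \<longleftrightarrow> i \<in> I"
  by (auto simp: ext_def)

lemma ext_cases [consumes 1, case_names zero Suc]:
  "n \<in> ext I \<Longrightarrow> (n = 0 \<Longrightarrow> P) \<Longrightarrow> (\<And>i. n = Suc i \<Longrightarrow> i \<in> I \<Longrightarrow> P) \<Longrightarrow> P"
  by (auto simp: ext_def)

lemma sum_ext: "finite I \<Longrightarrow> (\<Sum>n\<in>ext I. f n) = f 0 + (\<Sum>i\<in>I. f (Suc i))"
  by (simp add: ext_def sum.reindex)

definition unit_vec_fn :: "nat \<Rightarrow> nat \<Rightarrow> real" where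
  "unit_vec_fn a i = (if i = a then 1 else 0)"

lemma unit_vec_nonneg [simp]: "0 \<le> unit_vec_fn a i"
  by (simp add: unit_vec_fn_def)

lemma unit_vec_simps [simp]:
  "unit_vec_fn a a = 1" "unit_vec_fn 0 (Suc i) = 0" "unit_vec_fn (Suc i) 0 = 0"
  "unit_vec_fn (Suc i) (Suc j) = unit_vec_fn i j"
  by (simp_all add: unit_vec_fn_def)

lemma sum_unit_vec [simp]:
  assumes "finite I" "a \<in> I"
  shows "(\<Sum>i\<in>I. f i * unit_vec_fn a i) = f a" "(\<Sum>i\<in>I. unit_vec_fn a i * f i) = f a"
    "(\<Sum>i\<in>I. f i * unit_vec_fn i a) = f a" "(\<Sum>i\<in>I. unit_vec_fn i a * f i) = f a"
proof -
  have f: "(\<Sum>i\<in>I. f i * (if i = a then 1 else 0)) = f a"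
    using assms by (simp add: if_distrib cong: if_cong)
  have u: "unit_vec_fn a = (\<lambda>i. if i = a then 1 else 0)" "(\<lambda>i. unit_vec_fn i a) = (\<lambda>i. if i = a then 1 else 0)"
    by (auto simp: unit_vec_fn_def)
  show "(\<Sum>i\<in>I. f i * unit_vec_fn a i) = f a" using f by (simp add: u)
  then show "(\<Sum>i\<in>I. unit_vec_fn a i * f i) = f a" by (simp add: mult.commute)
  show "(\<Sum>i\<in>I. f i * unit_vec_fn i a) = f a" using f by (simp add: fun_cong[OF u(2)])
  then show "(\<Sum>i\<in>I. unit_vec_fn i a * f i) = f a" by (simp add: mult.commute)
qed

text \<open>
  The blocks \<open>[A - y x | y]\<close>, and \<open>1\<close> on top of the row \<open>x\<close>, have the product \<open>A\<close>; the reversed product, on the states of \<open>A\<close>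
  shifted by one together with the new state \<open>0\<close>, is the blow-up of \<open>A\<close> along the column \<open>y\<close> and the
  row \<open>x\<close>.
\<close>

fun blow_cols :: "(nat \<Rightarrow> nat \<Rightarrow> real) \<Rightarrow> (nat \<Rightarrow> real) \<Rightarrow> (nat \<Rightarrow> real) \<Rightarrow> nat \<Rightarrow> nat \<Rightarrow> real" where
  "blow_cols A x y i 0 = y i"
| "blow_cols A x y i (Suc j) = A i j - y i * x j"

fun blow_rows :: "(nat \<Rightarrow> real) \<Rightarrow> nat \<Rightarrow> nat \<Rightarrow> real" where
  "blow_rows x 0 j = x j"
| "blow_rows x (Suc i) j = unit_vec_fn i j"

definition blow_up ::
  "nat set \<Rightarrow> (nat \<Rightarrow> nat \<Rightarrow> real) \<Rightarrow> (nat \<Rightarrow> real) \<Rightarrow> (nat \<Rightarrow> real) \<Rightarrow> nat \<Rightarrow> nat \<Rightarrow> real" where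
  "blow_up I A x y m n = (\<Sum>i\<in>I. blow_rows x m i * blow_cols A x y i n)"

lemma blow_up_Suc:
  "finite I \<Longrightarrow> i \<in> I \<Longrightarrow> blow_up I A x y (Suc i) n = blow_cols A x y i n"
  by (simp add: blow_up_def)

text \<open>
  Splitting off a quarter of the row of the mark.  The row of the new mark sees what the
  square of \<open>A\<close> sees from \<open>a\<close>, so that repeated mark blow-ups spread the support of that row.
\<close>

fun mark_blow :: "system \<Rightarrow> system" where
  "mark_blow (I, A, a) = (ext I, blow_up I A (\<lambda>j. A a j / 4) (unit_vec_fn a), 0)"

text \<open>
  The mark blow-ups of \<open>A = R S\<close> and \<open>B = S R\<close> are linked in three steps.  Write \<open>e\<^sub>a\<close>, \<open>e\<^sub>b\<close> for unit columns and \<open>R\<^sub>a\<close> for a row.  The mark blow-up of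
  \<open>A = R S\<close> at \<open>a\<close> is carried over to the blow-up \<open>B\<^sub>1\<close> of \<open>B = S R\<close> along \<open>S e\<^sub>a\<close> and
  \<open>R\<^sub>a / 4\<close>.  Since \<open>S e\<^sub>a\<close> contains \<open>S\<^sub>b\<^sub>a e\<^sub>b\<close>, both \<open>B\<^sub>1\<close> and the mark blow-up of \<open>B\<close>
  at \<open>b\<close> can be blown up once more to the same system, in which \<open>B\<close> is blown up along the two columns
  \<open>S e\<^sub>a - S\<^sub>b\<^sub>a e\<^sub>b\<close>, \<open>e\<^sub>b\<close> and the two rows \<open>R\<^sub>a / 4\<close>, \<open>B\<^sub>b / 4\<close>.
\<close>

fun double_cols where
  "double_cols B x y x' b k 0 = y k"
| "double_cols B x y x' b k (Suc 0) = unit_vec_fn b k"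
| "double_cols B x y x' b k (Suc (Suc l)) = B k l - y k * x l - unit_vec_fn b k * x' l"

fun double_rows where
  "double_rows x x' 0 k = x k"
| "double_rows x x' (Suc 0) k = x' k"
| "double_rows x x' (Suc (Suc i)) k = unit_vec_fn i k"

text \<open>
  In blocks, with \<open>D = 1 - e\<^sub>a e\<^sub>a\<^sup>T / 4\<close>, the matrix of the mark blow-up has the rows \<open>D R S | e\<^sub>a\<close>
  and the other one the rows \<open>S D R | S e\<^sub>a\<close>; they share \<open>T = [D R | e\<^sub>a]\<close> and differ by the
  block diagonal matrix of \<open>S\<close> and \<open>1\<close>.  The new marked row contains the support of
  \<open>A\<^sub>a R = R\<^sub>a B\<close>, which accounts for the step gained.
\<close>

lemma link_mark_blow_first:
  assumes mp: "marked_pair I A a J B b R S" and c: "catches J (R a) B (Suc q)"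
  shows "(mark_blow (I, A, a), (ext J, blow_up J B (\<lambda>l. R a l / 4) (\<lambda>k. S k a), 0)) \<in> link q"
proof -
  have fin: "finite I" "finite J" and marks: "a \<in> I" "b \<in> J"
    and A: "\<And>i j. i \<in> I \<Longrightarrow> j \<in> I \<Longrightarrow> A i j = (\<Sum>k\<in>J. R i k * S k j)"
    and B: "\<And>k l. k \<in> J \<Longrightarrow> l \<in> J \<Longrightarrow> B k l = (\<Sum>i\<in>I. S k i * R i l)"
    and R0: "\<And>i k. i \<in> I \<Longrightarrow> k \<in> J \<Longrightarrow> 0 \<le> R i k" and S0: "\<And>i k. i \<in> I \<Longrightarrow> k \<in> J \<Longrightarrow> 0 \<le> S k i"
    using mp by (auto simp: marked_pair_def)
  have A0: "\<And>i j. i \<in> I \<Longrightarrow> j \<in> I \<Longrightarrow> 0 \<le> A i j"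
    and Sa: "\<And>k l. k \<in> J \<Longrightarrow> l \<in> J \<Longrightarrow> S k a * R a l \<le> B k l"
    and Aa: "0 < A a a"
    using marked_pair_nonneg[OF mp] marked_pair_ge_term[OF marked_pair_sym[OF mp]] marks
      marked_pair_loop[OF mp] by auto
  define x where "x = (\<lambda>j. A a j / 4)"
  define x0 where "x0 = (\<lambda>l. R a l / 4)"
  define y0 where "y0 = (\<lambda>k. S k a)"
  define V where "V = blow_rows x"
  define U where "U = blow_cols A x (unit_vec_fn a)"
  define T where "T = blow_cols R x0 (unit_vec_fn a)"
  define W where "W = (\<lambda>n i. case n of 0 \<Rightarrow> x i | Suc k \<Rightarrow> S k i)"
  define S' where "S' = (\<lambda>n p. case n of 0 \<Rightarrow> unit_vec_fn 0 p | Suc k \<Rightarrow> (case p of 0 \<Rightarrow> 0 | Suc i \<Rightarrow> S k i))"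
  define A' where "A' = blow_up I A x (unit_vec_fn a)"
  define M where "M = blow_up J B x0 y0"
  have T0: "0 \<le> T i n" if "i \<in> I" "n \<in> ext J" for i n
    using that R0 by (auto simp: T_def x0_def unit_vec_fn_def elim!: ext_cases)
  have T_ge: "3/4 * R i l \<le> T i (Suc l)" "T i (Suc l) \<le> R i l" if "i \<in> I" "l \<in> J" for i l
    using that R0 by (auto simp: T_def x0_def unit_vec_fn_def)
  have M_Suc: "M (Suc k) n = (\<Sum>i\<in>I. S k i * T i n)" if "k \<in> J" "n \<in> ext J" for k n
    using \<open>n \<in> ext J\<close>
  proof (cases rule: ext_cases)
    case zero
    then show ?thesis using that fin marks by (simp add: M_def blow_up_Suc T_def y0_def)
  next
    case (Suc l)
    have "(\<Sum>i\<in>I. S k i * T i n) = B k l - (\<Sum>i\<in>I. (S k i * unit_vec_fn a i) * x0 l)"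
      using Suc that by (simp add: T_def B right_diff_distrib sum_subtractf mult.assoc)
    also have "\<dots> = B k l - S k a * x0 l"
      using fin marks by (simp flip: sum_distrib_right)
    finally show ?thesis using Suc that fin by (simp add: M_def blow_up_Suc y0_def)
  qed
  have M_0: "M 0 n = (\<Sum>i\<in>I. x i * T i n)" if "n \<in> ext J" for n
  proof -
    have "M 0 n = (\<Sum>k\<in>J. x0 k * M (Suc k) n)"
      using fin by (simp add: M_def blow_up_Suc) (simp add: blow_up_def)
    also have "\<dots> = (\<Sum>k\<in>J. \<Sum>i\<in>I. x0 k * S k i * T i n)"
      using M_Suc that by (simp add: sum_distrib_left mult.assoc)
    also have "\<dots> = (\<Sum>i\<in>I. \<Sum>k\<in>J. x0 k * S k i * T i n)"
      by (rule sum.swap)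
    also have "\<dots> = (\<Sum>i\<in>I. x i * T i n)"
    proof (rule sum.cong[OF refl])
      fix i assume "i \<in> I"
      then have "x i = (\<Sum>k\<in>J. x0 k * S k i)"
        using A marks by (simp add: x_def x0_def sum_divide_distrib)
      then show "(\<Sum>k\<in>J. x0 k * S k i * T i n) = x i * T i n"
        by (simp add: sum_distrib_right)
    qed
    finally show ?thesis .
  qed
  have Ra: "0 < (\<Sum>i\<in>I. x i * T i 0)" using fin marks Aa by (simp add: T_def) (simp add: x_def)
  have "marked_pair (ext I) A' 0 (ext J) M 0 (\<lambda>p n. \<Sum>i\<in>I. V p i * T i n) S'"
  proof (rule marked_pair_through[where U = U and W = W])
    show "A' p p' = (\<Sum>k\<in>I. V p k * U k p')" for p p'
      by (simp add: A'_def blow_up_def V_def U_def)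
    show "U i p = (\<Sum>n\<in>ext J. T i n * S' n p)" if "i \<in> I" "p \<in> ext I" for i p
      using \<open>p \<in> ext I\<close>
    proof (cases rule: ext_cases)
      case zero
      then show ?thesis using fin by (simp add: sum_ext U_def T_def S'_def)
    next
      case (Suc j)
      have "(\<Sum>n\<in>ext J. T i n * S' n p) = (\<Sum>k\<in>J. R i k * S k j) - (\<Sum>k\<in>J. unit_vec_fn a i * (x0 k * S k j))"
        using Suc fin by (simp add: sum_ext T_def S'_def left_diff_distrib sum_subtractf mult.assoc unit_vec_fn_def)
      also have "\<dots> = U i p"
        using Suc A that marks by (simp add: U_def x_def x0_def sum_divide_distrib sum_distrib_left)
      finally show ?thesis by simp
    qed
    show "M n n' = (\<Sum>i\<in>I. W n i * T i n')" if "n \<in> ext J" "n' \<in> ext J" for n n'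
      using that by (auto simp: W_def M_0 M_Suc elim: ext_cases[of n])
    show "W n i = (\<Sum>p\<in>ext I. S' n p * V p i)" if "n \<in> ext J" "i \<in> I" for n i
      using that fin by (auto simp: W_def S'_def V_def sum_ext elim!: ext_cases)
    show "0 \<le> V p k" if "p \<in> ext I" "k \<in> I" for p k
      using that A0 marks by (auto simp: V_def x_def elim!: ext_cases)
    show "0 \<le> S' n p" if "n \<in> ext J" "p \<in> ext I" for n p
      using that S0 by (auto simp: S'_def elim!: ext_cases)
    show "0 < (\<Sum>k\<in>I. V 0 k * T k 0)" using Ra by (simp add: V_def)
    show "0 < S' 0 0" by (simp add: S'_def)
  qed (use fin marks T0 in auto)
  moreover have "catches (ext J) (\<lambda>n. \<Sum>i\<in>I. V 0 i * T i n) M q"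
  proof (rule catches_extend[OF c, where f = Suc and N = "{0}"])
    show "0 < M (Suc k) (Suc l) \<longleftrightarrow> 0 < B k l" if "k \<in> J" "l \<in> J" for k l
    proof -
      have "M (Suc k) (Suc l) = B k l - S k a * R a l / 4"
        using that fin by (simp add: M_def blow_up_Suc x0_def y0_def)
      moreover have "0 \<le> S k a * R a l" using that S0 R0 marks by simp
      ultimately show ?thesis using Sa[OF that] by linarith
    qed
    show "0 < (\<Sum>i\<in>I. V 0 i * T i (Suc l))" if kl: "k \<in> J" "l \<in> J" "0 < R a k" "0 < B k l" for k l
    proof -
      obtain i where i: "i \<in> I" "0 < S k i" "0 < R i l"
        using marked_pair_edge_iff[OF marked_pair_sym[OF mp], of k l] kl by blast
      have "0 < A a i" using marked_pair_edge_iff[OF mp] i marks kl by blast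
      moreover have "0 < T i (Suc l)" using T_ge[of i l] i kl by linarith
      ultimately show ?thesis
        using i fin T0 A0 marks kl
        by (intro sum_pos2[of _ i]) (auto simp: V_def x_def)
    qed
    show "0 < (\<Sum>i\<in>I. V 0 i * T i n) \<or> (\<forall>m\<in>ext J. 0 < M n m \<longrightarrow> 0 < (\<Sum>i\<in>I. V 0 i * T i m))"
      if "n \<in> {0}" for n using that Ra by (simp add: V_def)
  qed (auto simp: ext_def)
  ultimately show ?thesis
    unfolding link_def A'_def M_def x_def x0_def y0_def by auto
qed

text \<open>
  The common double blow-up \<open>M\<close> is marked at its state \<open>Suc 0\<close>, which belongs to the column \<open>e\<^sub>b\<close>.
  In both cases the inequality \<open>B\<^sub>b \<ge> S\<^sub>b\<^sub>a R\<^sub>a\<close> is decisive: it makes the factor \<open>S1\<close> nonnegative,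
  and it lets the row \<open>B\<^sub>b\<close> see what \<open>R\<^sub>a\<close> sees.  The state \<open>0\<close> of \<open>M\<close> may be missed by the marked
  row, but everything that it sees is seen by that row.
\<close>

lemma link_common_double_blow:
  assumes mp: "marked_pair I A a J B b R S" and c: "catches J (R a) B (Suc q)"
  shows "\<exists>t. ((ext J, blow_up J B (\<lambda>l. R a l / 4) (\<lambda>k. S k a), 0), t) \<in> link q \<and>
             (mark_blow (J, B, b), t) \<in> link q"
proof -
  have fin: "finite I" "finite J" and marks: "a \<in> I" "b \<in> J"
    and R0: "\<And>i k. i \<in> I \<Longrightarrow> k \<in> J \<Longrightarrow> 0 \<le> R i k" and S0: "\<And>i k. i \<in> I \<Longrightarrow> k \<in> J \<Longrightarrow> 0 \<le> S k i"
    and pos: "0 < R a b" "0 < S b a"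
    using mp by (auto simp: marked_pair_def)
  have B0: "\<And>k l. k \<in> J \<Longrightarrow> l \<in> J \<Longrightarrow> 0 \<le> B k l"
    and Sa: "\<And>k l. k \<in> J \<Longrightarrow> l \<in> J \<Longrightarrow> S k a * R a l \<le> B k l"
    and Bb: "0 < B b b"
    using marked_pair_nonneg[OF marked_pair_sym[OF mp]]
      marked_pair_ge_term[OF marked_pair_sym[OF mp]] marks
      marked_pair_loop[OF marked_pair_sym[OF mp]] by auto
  define s where "s = S b a"
  define x where "x = (\<lambda>l. R a l / 4)"
  define y where "y = (\<lambda>k. S k a)"
  define x' where "x' = (\<lambda>l. B b l / 4)"
  define d where "d = (\<lambda>k. y k - s * unit_vec_fn b k)"
  define T where "T = double_cols B x d x' b"
  define W where "W = double_rows x x'"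
  define N where "N = ext (ext J)"
  define M where "M = (\<lambda>n n'. \<Sum>k\<in>J. W n k * T k n')"
  have s: "0 < s" and x0: "\<And>l. l \<in> J \<Longrightarrow> 0 \<le> x l" and x'0: "\<And>l. l \<in> J \<Longrightarrow> 0 \<le> x' l"
    using pos R0 B0 marks by (auto simp: s_def x_def x'_def)
  have sx: "s * x l \<le> x' l" if "l \<in> J" for l
    using Sa[OF marks(2) that] by (simp add: s_def x_def x'_def)
  have d0: "0 \<le> d k" if "k \<in> J" for k
    using S0 marks that by (auto simp: d_def y_def s_def unit_vec_fn_def)
  have T_SS: "3/4 * B k l \<le> T k (Suc (Suc l))" "T k (Suc (Suc l)) \<le> B k l"
    if "k \<in> J" "l \<in> J" for k l
  proof -
    have "0 \<le> S k a * R a l" using S0 R0 marks that by simp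
    then show "3/4 * B k l \<le> T k (Suc (Suc l))" "T k (Suc (Suc l)) \<le> B k l"
      using Sa[OF that] B0[OF that]
      by (auto simp: T_def d_def y_def s_def x_def x'_def unit_vec_fn_def field_simps)
  qed
  have N_cases: thesis if "n \<in> N" "n = 0 \<Longrightarrow> thesis" "n = Suc 0 \<Longrightarrow> thesis"
    "\<And>i. n = Suc (Suc i) \<Longrightarrow> i \<in> J \<Longrightarrow> thesis" for n thesis
    using that by (auto simp: N_def elim!: ext_cases)
  have sum_N: "(\<Sum>n\<in>N. f n) = f 0 + (f (Suc 0) + (\<Sum>i\<in>J. f (Suc (Suc i))))" for f :: "nat \<Rightarrow> real"
    using fin by (simp add: N_def sum_ext)
  have T0: "0 \<le> T k n" if "k \<in> J" "n \<in> N" for k n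
    using \<open>n \<in> N\<close>
  proof (rule N_cases)
    fix i assume "n = Suc (Suc i)" "i \<in> J"
    then show ?thesis using T_SS(1)[OF \<open>k \<in> J\<close>, of i] B0[OF \<open>k \<in> J\<close>, of i] by simp
  qed (use that d0 in \<open>auto simp: T_def\<close>)
  have M_SS: "M (Suc (Suc k)) n = T k n" if "k \<in> J" for k n
    using fin that by (simp add: M_def W_def)
  have M_edge: "0 < M (Suc (Suc k)) (Suc (Suc l)) \<longleftrightarrow> 0 < B k l" if "k \<in> J" "l \<in> J" for k l
    unfolding M_SS[OF that(1)] using T_SS[OF that] by linarith
  \<comment> \<open>Both rows that have to catch the paths of \<open>M\<close> have the form \<open>v T\<close>, where \<open>v\<close> dominates
    \<open>R\<^sub>a\<close> up to a factor.\<close>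
  have catch: "catches N (\<lambda>n. \<Sum>k\<in>J. v k * T k n) M q"
    if v: "\<And>k. k \<in> J \<Longrightarrow> e * x k \<le> v k" and e: "0 < e" for v and e :: real
  proof -
    have v0: "0 \<le> v k" if "k \<in> J" for k
      using v[OF that] mult_nonneg_nonneg[of e "x k"] e x0[OF that] by linarith
    have vpos: "0 < v k" if "k \<in> J" "0 < R a k" for k
    proof -
      have "0 < e * x k" using e that(2) by (simp add: x_def)
      then show ?thesis using v[OF that(1)] by linarith
    qed
    show ?thesis
    proof (rule catches_extend[OF c, where f = "\<lambda>k. Suc (Suc k)" and N = "{0, Suc 0}"])
      show "N = (\<lambda>k. Suc (Suc k)) ` J \<union> {0, Suc 0}" by (auto simp: N_def ext_def)
      show "inj_on (\<lambda>k. Suc (Suc k)) J" by (simp add: inj_on_def)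
      show "0 < M (Suc (Suc k)) (Suc (Suc l)) \<longleftrightarrow> 0 < B k l" if "k \<in> J" "l \<in> J" for k l
        using M_edge that .
      show "0 < (\<Sum>i\<in>J. v i * T i (Suc (Suc l)))"
        if "k \<in> J" "l \<in> J" "0 < R a k" "0 < B k l" for k l
      proof (rule sum_pos2[of J k])
        show "0 < v k * T k (Suc (Suc l))"
          using vpos[of k] T_SS(1)[of k l] that by simp
        show "0 \<le> v i * T i (Suc (Suc l))" if "i \<in> J" for i
          using v0[of i] T0[of i "Suc (Suc l)"] that \<open>l \<in> J\<close> by (simp add: N_def)
      qed (use that fin in auto)
      show "0 < (\<Sum>k\<in>J. v k * T k n) \<or> (\<forall>m\<in>N. 0 < M n m \<longrightarrow> 0 < (\<Sum>k\<in>J. v k * T k m))"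
        if "n \<in> {0, Suc 0}" for n
      proof (cases "n = 0")
        case True
        have "e * M 0 m \<le> (\<Sum>k\<in>J. v k * T k m)" if "m \<in> N" for m
          unfolding M_def sum_distrib_left using v T0 that
          by (intro sum_mono) (auto simp: W_def mult.assoc[symmetric] intro!: mult_right_mono)
        moreover have "0 < M 0 m \<Longrightarrow> 0 < e * M 0 m" for m using e by simp
        ultimately show ?thesis using True by (meson less_le_trans)
      next
        case False
        then have "(\<Sum>k\<in>J. v k * T k n) = v b" using that fin marks by (simp add: T_def)
        then show ?thesis using vpos[of b] marks pos by simp
      qed
    qed
  qed
  define S1 where "S1 = (\<lambda>n p. case n of 0 \<Rightarrow> unit_vec_fn 0 p
    | Suc m \<Rightarrow> (case m of 0 \<Rightarrow> (case p of 0 \<Rightarrow> s | Suc j \<Rightarrow> x' j - s * x j) | Suc i \<Rightarrow> unit_vec_fn (Suc i) p))"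
  define S2 where "S2 = (\<lambda>n p. case n of 0 \<Rightarrow> (case p of 0 \<Rightarrow> 0 | Suc j \<Rightarrow> x j)
    | Suc m \<Rightarrow> (case m of 0 \<Rightarrow> unit_vec_fn 0 p | Suc i \<Rightarrow> unit_vec_fn (Suc i) p))"
  have "marked_pair (ext J) (blow_up J B x y) 0 N M (Suc 0)
          (\<lambda>p n. \<Sum>k\<in>J. blow_rows x p k * T k n) S1"
  proof (rule marked_pair_through[where U = "blow_cols B x y" and W = W])
    show "blow_cols B x y k p = (\<Sum>n\<in>N. T k n * S1 n p)" if "k \<in> J" "p \<in> ext J" for k p
      using \<open>p \<in> ext J\<close> fin that
      by (cases rule: ext_cases) (simp_all add: sum_N S1_def T_def, simp_all add: d_def algebra_simps)
    show "W n k = (\<Sum>p\<in>ext J. S1 n p * blow_rows x p k)" if "n \<in> N" "k \<in> J" for n k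
      using \<open>n \<in> N\<close> by (rule N_cases) (use fin that in \<open>simp_all add: sum_ext S1_def W_def\<close>)
    show "0 \<le> blow_rows x p k" if "p \<in> ext J" "k \<in> J" for p k
      using that x0 by (auto elim!: ext_cases)
    show "0 \<le> S1 n p" if "n \<in> N" "p \<in> ext J" for n p
      using \<open>n \<in> N\<close> by (rule N_cases) (use that s sx in \<open>auto simp: S1_def elim!: ext_cases\<close>)
    show "0 < (\<Sum>k\<in>J. blow_rows x 0 k * T k (Suc 0))"
      using fin marks pos by (simp add: T_def) (simp add: x_def)
  qed (use fin s T0 in \<open>auto simp: blow_up_def M_def S1_def N_def\<close>)
  moreover have "catches N (\<lambda>n. \<Sum>k\<in>J. blow_rows x 0 k * T k n) M q"
    by (rule catch[of 1]) auto
  ultimately have 1: "((ext J, blow_up J B x y, 0), (N, M, Suc 0)) \<in> link q"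
    unfolding link_def by auto
  have "marked_pair (ext J) (blow_up J B x' (unit_vec_fn b)) 0 N M (Suc 0)
          (\<lambda>p n. \<Sum>k\<in>J. blow_rows x' p k * T k n) S2"
  proof (rule marked_pair_through[where U = "blow_cols B x' (unit_vec_fn b)" and W = W])
    show "blow_cols B x' (unit_vec_fn b) k p = (\<Sum>n\<in>N. T k n * S2 n p)" if "k \<in> J" "p \<in> ext J" for k p
      using \<open>p \<in> ext J\<close> fin that
      by (cases rule: ext_cases) (simp_all add: sum_N S2_def T_def)
    show "W n k = (\<Sum>p\<in>ext J. S2 n p * blow_rows x' p k)" if "n \<in> N" "k \<in> J" for n k
      using \<open>n \<in> N\<close> by (rule N_cases) (use fin that in \<open>simp_all add: sum_ext S2_def W_def\<close>)
    show "0 \<le> blow_rows x' p k" if "p \<in> ext J" "k \<in> J" for p k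
      using that x'0 by (auto elim!: ext_cases)
    show "0 \<le> S2 n p" if "n \<in> N" "p \<in> ext J" for n p
      using \<open>n \<in> N\<close> by (rule N_cases) (use that x0 in \<open>auto simp: S2_def elim!: ext_cases\<close>)
    show "0 < (\<Sum>k\<in>J. blow_rows x' 0 k * T k (Suc 0))"
      using fin marks Bb by (simp add: T_def) (simp add: x'_def)
  qed (use fin s T0 in \<open>auto simp: blow_up_def M_def S2_def N_def\<close>)
  moreover have "catches N (\<lambda>n. \<Sum>k\<in>J. blow_rows x' 0 k * T k n) M q"
    by (rule catch[of s]) (use sx s in auto)
  ultimately have 2: "(mark_blow (J, B, b), (N, M, Suc 0)) \<in> link q"
    unfolding link_def mark_blow.simps x'_def by auto
  from 1 2 show ?thesis unfolding x_def y_def by blast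
qed

lemma linked_mark_blow_link:
  assumes "(s, t) \<in> link (Suc q)"
  shows "(mark_blow s, mark_blow t) \<in> linked q"
proof -
  obtain I A a J B b where st: "s = (I, A, a)" "t = (J, B, b)" by (metis prod_cases3)
  then obtain R S where "marked_pair I A a J B b R S" "catches J (R a) B (Suc q)"
    using assms unfolding link_def by auto
  from link_mark_blow_first[OF this] link_common_double_blow[OF this] show ?thesis
    unfolding st by (meson link_linked linked_sym linked_trans)
qed

lemma linked_mark_blow:
  assumes "(s, t) \<in> linked (Suc q)"
  shows "(mark_blow s, mark_blow t) \<in> linked q"
  using assms unfolding linked_def[of "Suc q"]
proof (induction rule: rtrancl_induct)
  case base
  then show ?case by (simp add: linked_def)
next
  case (step t u)
  then show ?case
    by (metis Un_iff converse_iff linked_mark_blow_link linked_sym linked_trans)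
qed

text \<open>
  If the row of the mark is positive, then it catches everything at once, and the mark blow-up
  inherits this positivity.
\<close>

lemma link_mark_blow_positive_row:
  assumes "finite I" "a \<in> I" "\<And>i j. i \<in> I \<Longrightarrow> j \<in> I \<Longrightarrow> 0 \<le> A i j" "\<And>j. j \<in> I \<Longrightarrow> 0 < A a j"
  shows "((I, A, a), mark_blow (I, A, a)) \<in> link 0"
    and "n \<in> ext I \<Longrightarrow> 0 < blow_up I A (\<lambda>j. A a j / 4) (unit_vec_fn a) 0 n"
    and "m \<in> ext I \<Longrightarrow> n \<in> ext I \<Longrightarrow> 0 \<le> blow_up I A (\<lambda>j. A a j / 4) (unit_vec_fn a) m n"
proof -
  define x where "x = (\<lambda>j. A a j / 4)"
  define U where "U = blow_cols A x (unit_vec_fn a)"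
  have U0: "0 \<le> U i n" if "i \<in> I" "n \<in> ext I" for i n
    using that assms(3) by (auto simp: U_def x_def unit_vec_fn_def elim!: ext_cases)
  have Ua: "0 < U a n" if "n \<in> ext I" for n
    using that assms(4) by (auto simp: U_def x_def elim!: ext_cases)
  have V0: "0 \<le> blow_rows x n i" if "i \<in> I" "n \<in> ext I" for i n
    using that assms(2,3) by (auto simp: x_def elim!: ext_cases)
  have "A i j = (\<Sum>n\<in>ext I. U i n * blow_rows x n j)" if "i \<in> I" "j \<in> I" for i j
    using that assms(1) by (simp add: sum_ext U_def)
  then have "marked_pair I A a (ext I) (blow_up I A x (unit_vec_fn a)) 0 U (blow_rows x)"
    using assms U0 V0 Ua by (auto simp: marked_pair_def blow_up_def U_def x_def)
  moreover have "catches (ext I) (U a) (blow_up I A x (unit_vec_fn a)) 0"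
    using Ua by (auto simp: catches_def)
  ultimately show "((I, A, a), mark_blow (I, A, a)) \<in> link 0"
    unfolding link_def x_def by auto
  show "0 < blow_up I A (\<lambda>j. A a j / 4) (unit_vec_fn a) 0 n" if "n \<in> ext I"
    unfolding blow_up_def x_def[symmetric] U_def[symmetric]
  proof (rule sum_pos2[of I a])
    show "0 < blow_rows x 0 a * U a n" using Ua[OF that] assms(2,4) by (simp add: x_def)
  qed (use assms U0 that in \<open>auto simp: x_def\<close>)
  show "0 \<le> blow_up I A (\<lambda>j. A a j / 4) (unit_vec_fn a) m n" if "m \<in> ext I" "n \<in> ext I"
    unfolding blow_up_def x_def[symmetric] U_def[symmetric]
    using V0 U0 that by (intro sum_nonneg) auto
qed

lemma linked_iterated_mark_blow:
  assumes "finite I" "a \<in> I" "\<And>i j. i \<in> I \<Longrightarrow> j \<in> I \<Longrightarrow> 0 \<le> A i j" "\<And>j. j \<in> I \<Longrightarrow> 0 < A a j"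
  shows "((I, A, a), (mark_blow ^^ n) (I, A, a)) \<in> linked 0"
  using assms
proof (induction n arbitrary: I A a)
  case 0
  show ?case by (simp add: linked_def)
next
  case (Suc n)
  note pos = link_mark_blow_positive_row[where I = I and a = a and A = A, OF Suc.prems]
  have "(mark_blow (I, A, a), (mark_blow ^^ n) (mark_blow (I, A, a))) \<in> linked 0"
    unfolding mark_blow.simps using Suc.prems(1) pos(2,3) by (intro Suc.IH) auto
  then show ?case using link_linked[OF pos(1)] linked_trans by (simp add: funpow_swap1)
qed

text \<open>
  Both ends are moved to their \<open>q\<close>-fold blow-ups, between which \<open>q\<close> applications of
  \<open>linked_mark_blow\<close> have reduced the delay to \<open>0\<close>.
\<close>

lemma linked_0_if_linked:
  assumes "((I, A, a), (J, B, b)) \<in> linked q"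
    and "finite I" "a \<in> I" "\<And>i j. i \<in> I \<Longrightarrow> j \<in> I \<Longrightarrow> 0 < A i j"
    and "finite J" "b \<in> J" "\<And>i j. i \<in> J \<Longrightarrow> j \<in> J \<Longrightarrow> 0 < B i j"
  shows "((I, A, a), (J, B, b)) \<in> linked 0"
proof -
  have "(s, t) \<in> linked q \<Longrightarrow> ((mark_blow ^^ q) s, (mark_blow ^^ q) t) \<in> linked 0" for s t
  proof (induction q arbitrary: s t)
    case (Suc q)
    then show ?case using linked_mark_blow by (simp add: funpow_swap1)
  qed simp
  from this[OF assms(1)] show ?thesis
    using linked_iterated_mark_blow[of I a A q] linked_iterated_mark_blow[of J b B q] assms(2-)
    by (meson less_imp_le linked_sym linked_trans)
qed

section \<open>Strong components of the marks\<close>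

definition edges :: "'i set \<Rightarrow> ('i \<Rightarrow> 'i \<Rightarrow> real) \<Rightarrow> ('i \<times> 'i) set" where
  "edges I A = {(i, j). i \<in> I \<and> j \<in> I \<and> 0 < A i j}"

definition mark_component :: "'i set \<Rightarrow> ('i \<Rightarrow> 'i \<Rightarrow> real) \<Rightarrow> 'i \<Rightarrow> 'i set" where
  "mark_component I A a = {i \<in> I. (a, i) \<in> (edges I A)\<^sup>* \<and> (i, a) \<in> (edges I A)\<^sup>*}"

text \<open>A walk \<open>k \<rightarrow> i \<rightarrow> \<dots> \<rightarrow> j \<rightarrow> l\<close> read as \<open>S A\<^sup>n R = B\<^sup>n\<^sup>+\<^sup>1\<close>.\<close>

lemma walk_transfer:
  assumes mp: "marked_pair I A a J B b R S"
    and "(i, j) \<in> (edges I A)\<^sup>*" "i \<in> I" "k \<in> J" "0 < S k i" "l \<in> J" "0 < R j l"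
  shows "(k, l) \<in> (edges J B)\<^sup>*"
  using assms(2,6,7)
proof (induction arbitrary: l rule: rtrancl_induct)
  case base
  then have "(k, l) \<in> edges J B"
    using marked_pair_edge_iff[OF marked_pair_sym[OF mp], of k l] assms by (auto simp: edges_def)
  then show ?case by blast
next
  case (step j' j)
  then have e: "j' \<in> I" "j \<in> I" "0 < A j' j" by (auto simp: edges_def)
  then obtain m where m: "m \<in> J" "0 < R j' m" "0 < S m j"
    using marked_pair_edge_iff[OF mp, of j' j] by blast
  have "(k, m) \<in> (edges J B)\<^sup>*" using step.IH[OF m(1,2)] .
  moreover have "(m, l) \<in> edges J B"
    using marked_pair_edge_iff[OF marked_pair_sym[OF mp], of m l] m e step.prems
    by (auto simp: edges_def)
  ultimately show ?case by (rule rtrancl_into_rtrancl)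
qed

text \<open>
  An intermediate state of a product entry inside a strong component lies in the strong component of
  the other mark.  Hence the factorisations survive the restriction.
\<close>

lemma mark_component_between:
  assumes mp: "marked_pair I A a J B b R S"
    and "i \<in> mark_component I A a" "j \<in> mark_component I A a" "k \<in> J" "0 < R i k" "0 < S k j"
  shows "k \<in> mark_component J B b"
proof -
  have m: "a \<in> I" "b \<in> J" "0 < R a b" "0 < S b a" using mp by (auto simp: marked_pair_def)
  have "(b, k) \<in> (edges J B)\<^sup>*"
    using assms m by (intro walk_transfer[OF mp, of a i]) (auto simp: mark_component_def)
  moreover have "(k, b) \<in> (edges J B)\<^sup>*"
    using assms m by (intro walk_transfer[OF mp, of j a]) (auto simp: mark_component_def)
  ultimately show ?thesis using assms by (simp add: mark_component_def)
qed

lemma marked_pair_component_sum: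
  assumes mp: "marked_pair I A a J B b R S"
    and i: "i \<in> mark_component I A a" and j: "j \<in> mark_component I A a"
  shows "A i j = (\<Sum>k\<in>mark_component J B b. R i k * S k j)"
proof -
  have I: "i \<in> I" "j \<in> I" using i j by (auto simp: mark_component_def)
  have "R i k * S k j = 0" if "k \<in> J - mark_component J B b" for k
  proof (rule ccontr)
    assume "R i k * S k j \<noteq> 0"
    then have "0 < R i k" "0 < S k j"
      using mp I that by (auto simp: marked_pair_def less_le)
    then show False using mark_component_between[OF mp i j] that by blast
  qed
  then have "(\<Sum>k\<in>mark_component J B b. R i k * S k j) = (\<Sum>k\<in>J. R i k * S k j)"
    using mp by (intro sum.mono_neutral_left) (auto simp: marked_pair_def mark_component_def)
  then show ?thesis using mp I by (simp add: marked_pair_def)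
qed

lemma marked_pair_component:
  assumes mp: "marked_pair I A a J B b R S"
  shows "marked_pair (mark_component I A a) A a (mark_component J B b) B b R S"
proof -
  have "\<forall>i\<in>mark_component I A a. \<forall>j\<in>mark_component I A a.
          A i j = (\<Sum>k\<in>mark_component J B b. R i k * S k j)"
    using marked_pair_component_sum[OF mp] by blast
  moreover have "\<forall>i\<in>mark_component J B b. \<forall>j\<in>mark_component J B b.
          B i j = (\<Sum>k\<in>mark_component I A a. S i k * R k j)"
    using marked_pair_component_sum[OF marked_pair_sym[OF mp]] by blast
  ultimately show ?thesis
    using mp unfolding marked_pair_def by (auto simp: mark_component_def)
qed

lemma mark_component_reach:
  assumes "i \<in> mark_component I A a"
  shows "(a, i) \<in> (edges (mark_component I A a) A)\<^sup>*"
    and "(i, a) \<in> (edges (mark_component I A a) A)\<^sup>*"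
proof -
  let ?E = "edges I A" and ?C = "mark_component I A a"
  have ai: "(a, i) \<in> ?E\<^sup>*" "(i, a) \<in> ?E\<^sup>*" and "i \<in> I" using assms by (auto simp: mark_component_def)
  have inner: "(k, l) \<in> edges ?C A" if "(a, k) \<in> ?E\<^sup>*" "(k, l) \<in> ?E" "(l, a) \<in> ?E\<^sup>*" for k l
  proof -
    have "k \<in> I" "l \<in> I" using that by (auto simp: edges_def)
    moreover have "(a, l) \<in> ?E\<^sup>*" "(k, a) \<in> ?E\<^sup>*" using that by auto
    ultimately show ?thesis using that by (simp add: mark_component_def edges_def)
  qed
  have "(k, a) \<in> ?E\<^sup>* \<Longrightarrow> (a, k) \<in> (edges ?C A)\<^sup>*" if "(a, k) \<in> ?E\<^sup>*" for k
    using that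
  proof (induction rule: rtrancl_induct)
    case (step k l)
    then show ?case using inner[of k l]
      by (meson converse_rtrancl_into_rtrancl rtrancl_into_rtrancl)
  qed simp
  then show "(a, i) \<in> (edges ?C A)\<^sup>*" using ai by blast
  have "(a, k) \<in> ?E\<^sup>* \<Longrightarrow> (k, a) \<in> (edges ?C A)\<^sup>*" if "(k, a) \<in> ?E\<^sup>*" for k
    using that
  proof (induction rule: converse_rtrancl_induct)
    case (step k l)
    then show ?case using inner[of k l]
      by (meson converse_rtrancl_into_rtrancl rtrancl_into_rtrancl)
  qed simp
  then show "(i, a) \<in> (edges ?C A)\<^sup>*" using ai by blast
qed

lemma mark_component_positive:
  assumes "a \<in> I" "\<And>i j. i \<in> I \<Longrightarrow> j \<in> I \<Longrightarrow> 0 < A i j"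
  shows "mark_component I A a = I"
  using assms by (auto simp: mark_component_def edges_def intro!: r_into_rtrancl)

text \<open>An irreducible matrix with a loop is primitive, so here all large \<open>q\<close> will do.\<close>

lemma catches_component:
  assumes mp: "marked_pair I A a J B b R S"
    and reach: "\<And>k. k \<in> J \<Longrightarrow> (b, k) \<in> (edges J B)\<^sup>*"
  shows "\<exists>q. catches J (R a) B q"
proof -
  have b: "b \<in> J" "0 < R a b" "0 < B b b" "finite J"
    using mp marked_pair_loop[OF marked_pair_sym[OF mp]] by (auto simp: marked_pair_def)
  have "\<exists>m. \<forall>q\<ge>m. k \<in> hits J (R a) B q" if "k \<in> J" for k
    using reach[OF that]
  proof (induction rule: rtrancl_induct)
    case base
    have "b \<in> hits J (R a) B q" for q
    proof (induction q)
      case (Suc q)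
      then show ?case using b by auto
    qed (use b in simp)
    then show ?case by blast
  next
    case (step k l)
    then obtain m where m: "\<forall>q\<ge>m. k \<in> hits J (R a) B q" by blast
    have "l \<in> hits J (R a) B q" if q: "Suc m \<le> q" for q
    proof -
      obtain q' where "q = Suc q'" "m \<le> q'" using q by (cases q) auto
      then show ?thesis using m step.hyps by (auto simp: edges_def)
    qed
    then show ?case by blast
  qed
  then obtain m where m: "\<And>k q. k \<in> J \<Longrightarrow> m k \<le> q \<Longrightarrow> k \<in> hits J (R a) B q" by metis
  have "catches J (R a) B (Max (m ` J))"
    unfolding catches_def
  proof (intro allI impI)
    fix c :: "nat \<Rightarrow> 'b"
    assume "\<forall>i. c i \<in> J \<and> 0 < B (c i) (c (Suc i))"
    then have "c 0 \<in> J" by blast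
    then have "c 0 \<in> hits J (R a) B (Max (m ` J))" using m b by simp
    then show "\<exists>i. c i \<in> hits J (R a) B (Max (m ` J))" by blast
  qed
  then show ?thesis by blast
qed

definition component_system :: "system \<Rightarrow> system" where
  "component_system s = (case s of (I, A, a) \<Rightarrow> (mark_component I A a, A, a))"

lemma linked_component_systems:
  assumes "marked_pair I A a J B b R S"
  shows "\<exists>q. (component_system (I, A, a), component_system (J, B, b)) \<in> linked q"
proof -
  note mp = marked_pair_component[OF assms]
  then obtain q where "catches (mark_component J B b) (R a) B q"
    using catches_component[OF mp] mark_component_reach(1) by metis
  then have "(component_system (I, A, a), component_system (J, B, b)) \<in> link q"
    using mp by (auto simp: link_def component_system_def)
  then show ?thesis using link_linked by blast
qed

section \<open>A theorem of the alternative\<close>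

inductive_set conic_span :: "('v \<Rightarrow> real) set \<Rightarrow> ('v \<Rightarrow> real) set" for C where
  gen: "f \<in> C \<Longrightarrow> f \<in> conic_span C"
| add: "f \<in> conic_span C \<Longrightarrow> g \<in> conic_span C \<Longrightarrow> (\<lambda>v. f v + g v) \<in> conic_span C"
| scale: "f \<in> conic_span C \<Longrightarrow> 0 < t \<Longrightarrow> (\<lambda>v. t * f v) \<in> conic_span C"

lemma real_between_finite_sets:
  fixes L H :: "real set"
  assumes "finite L" "finite H" "\<And>l h. l \<in> L \<Longrightarrow> h \<in> H \<Longrightarrow> l < h"
  shows "\<exists>t. (\<forall>l\<in>L. l < t) \<and> (\<forall>h\<in>H. t < h)"
proof (cases "L = {}")
  case True
  have "\<exists>t. \<forall>h\<in>H. t < h"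
    using assms(2) by (metis Min_le gt_ex less_le_trans lt_ex)
  then show ?thesis using True by blast
next
  case L: False
  show ?thesis
  proof (cases "H = {}")
    case True
    have "\<exists>t. \<forall>l\<in>L. l < t"
      using assms(1) by (metis Max_ge gt_ex le_less_trans)
    then show ?thesis using True by blast
  next
    case False
    then have "Max L < Min H" using assms L by simp
    then obtain t where "Max L < t" "t < Min H" using dense by blast
    then show ?thesis using assms(1,2) L False by auto
  qed
qed

text \<open>
  Gordan's alternative, by Fourier-Motzkin elimination of one variable after the other; the
  functionals left after an elimination are nonnegative combinations of the earlier ones.
\<close>

lemma gordan_alternative:
  assumes "finite V" "finite C"
  shows "(\<exists>x. \<forall>f\<in>C. 0 < (\<Sum>v\<in>V. f v * x v)) \<or> (\<exists>g\<in>conic_span C. \<forall>v\<in>V. g v = 0)"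
  using assms
proof (induction V arbitrary: C rule: finite_induct)
  case empty
  then show ?case using conic_span.gen by fastforce
next
  case (insert v V)
  define P where "P = {f \<in> C. 0 < f v}"
  define N where "N = {f \<in> C. f v < 0}"
  define E where "E = {f \<in> C. f v = 0}"
  define mix where "mix = (\<lambda>(p::'a \<Rightarrow> real, n::'a \<Rightarrow> real) u. p v * n u + (- n v) * p u)"
  define C' where "C' = E \<union> mix ` (P \<times> N)"
  have "finite C'" using insert.prems by (simp add: C'_def P_def N_def E_def)
  have zero: "g \<in> conic_span C \<and> g v = 0" if "g \<in> conic_span C'" for g
    using that
  proof (induction rule: conic_span.induct)
    case (gen f)
    then consider "f \<in> E" | p n where "p \<in> P" "n \<in> N" "f = mix (p, n)" by (auto simp: C'_def)
    then show ?case
    proof cases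
      case 1
      then show ?thesis by (auto simp: E_def intro: conic_span.gen)
    next
      case 2
      then have pn: "p \<in> conic_span C" "n \<in> conic_span C" "0 < p v" "0 < - n v"
        by (auto simp: P_def N_def intro: conic_span.gen)
      have "(\<lambda>u. p v * n u + (- n v) * p u) \<in> conic_span C"
        using pn by (intro conic_span.add conic_span.scale)
      then show ?thesis using 2 by (simp add: mix_def)
    qed
  qed (auto intro: conic_span.intros)
  consider x where "\<And>f. f \<in> C' \<Longrightarrow> 0 < (\<Sum>u\<in>V. f u * x u)" | g where "g \<in> conic_span C'" "\<forall>u\<in>V. g u = 0"
    using insert.IH[OF \<open>finite C'\<close>] by blast
  then show ?case
  proof cases
    case (1 x)
    note x = 1
    \<comment> \<open>The mixed functionals say that every lower bound on the value at \<open>v\<close> is below every upper one.\<close>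
    define val where "val = (\<lambda>f. (\<Sum>u\<in>V. f u * x u))"
    have mix_val: "val (mix (p, n)) = p v * val n + (- n v) * val p" for p n
      by (simp add: val_def mix_def sum.distrib sum_distrib_left algebra_simps sum_negf sum_subtractf)
    have "\<exists>t. (\<forall>l\<in>(\<lambda>p. - val p / p v) ` P. l < t) \<and> (\<forall>h\<in>(\<lambda>n. val n / (- n v)) ` N. t < h)"
    proof (rule real_between_finite_sets)
      fix l h
      assume "l \<in> (\<lambda>p. - val p / p v) ` P" "h \<in> (\<lambda>n. val n / (- n v)) ` N"
      then obtain p n where pn: "p \<in> P" "n \<in> N" and lh: "l = - val p / p v" "h = val n / (- n v)" by auto
      have "0 < val (mix (p, n))" using 1 pn by (auto simp: val_def C'_def)
      then have "- val p * (- n v) < val n * p v" by (simp add: mix_val algebra_simps)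
      moreover have "0 < p v" "0 < - n v" using pn by (auto simp: P_def N_def)
      ultimately show "l < h" unfolding lh by (simp add: frac_less_eq divide_less_eq less_divide_eq field_simps)
    qed (use insert.prems in \<open>auto simp: P_def N_def\<close>)
    then obtain t where tP: "\<And>p. p \<in> P \<Longrightarrow> - val p / p v < t" and tN: "\<And>n. n \<in> N \<Longrightarrow> t < val n / (- n v)"
      by auto
    have "0 < f v * t + val f" if fC: "f \<in> C" for f
    proof -
      consider "f \<in> P" | "f \<in> N" | "f \<in> E" using fC by (force simp: P_def N_def E_def)
      then show ?thesis
      proof cases
        case 1
        then have "0 < f v" by (simp add: P_def)
        then show ?thesis using tP[OF 1] by (simp only: divide_less_eq) (simp add: algebra_simps)
      next
        case 2
        then have "0 < - f v" by (simp add: N_def)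
        then show ?thesis using tN[OF 2] by (simp only: less_divide_eq) (simp add: algebra_simps)
      next
        case 3
        then show ?thesis using x[of f] fC by (simp add: C'_def E_def val_def)
      qed
    qed
    moreover have "(\<Sum>u\<in>insert v V. f u * (x(v := t)) u) = f v * t + val f" for f
      using insert.hyps by (auto simp: val_def intro!: sum.cong)
    ultimately show ?thesis by metis
  next
    case (2 g)
    then show ?thesis using zero by blast
  qed
qed

section \<open>Directions that make a marked pair positive\<close>

text \<open>
  The entries of \<open>X F - F Y\<close>, the derivative of \<open>(1 + e X) F (1 + e Y)\<^sup>-\<^sup>1\<close> at \<open>e = 0\<close>.
\<close>

definition tangent ::
  "'i set \<Rightarrow> 'k set \<Rightarrow> ('i \<Rightarrow> 'i \<Rightarrow> real) \<Rightarrow> ('i \<Rightarrow> 'k \<Rightarrow> real) \<Rightarrow> ('k \<Rightarrow> 'k \<Rightarrow> real) \<Rightarrow> 'i \<Rightarrow> 'k \<Rightarrow> real" where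
  "tangent I J X F Y i k = (\<Sum>j\<in>I. X i j * F j k) - (\<Sum>l\<in>J. F i l * Y l k)"

lemma marked_pair_row_nonzero:
  assumes mp: "marked_pair I A a J B b R S"
    and "(i, a) \<in> (edges I A)\<^sup>*" "i \<in> I"
  shows "\<exists>k\<in>J. 0 < R i k"
  using assms(2)
proof (cases rule: converse_rtranclE)
  case base
  then show ?thesis using mp by (auto simp: marked_pair_def)
next
  case (step j)
  then show ?thesis using marked_pair_edge_iff[OF mp, of i j] by (auto simp: edges_def)
qed

text \<open>
  If no pair of directions exists, then the alternative provides \<open>Q, P \<ge> 0\<close>, supported on the zeros
  of \<open>R\<close> and \<open>S\<close> (transposed), with \<open>R Q = P S\<close> and \<open>Q R = S P\<close>, hence \<open>Q A = B Q\<close>.  The column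
  \<open>v = Q e\<^sub>a\<close> satisfies \<open>B v \<ge> A\<^sub>a\<^sub>a v\<close>, so that a path of \<open>B\<close> can stay forever in its support, which
  lies in the zeros of \<open>R\<^sub>a\<close>.  This is what the catching property excludes, so \<open>v = 0\<close>; then
  \<open>Q A\<^sup>n e\<^sub>a = B\<^sup>n v = 0\<close> makes \<open>Q\<close> and \<open>P\<close> vanish.
\<close>

lemma marked_pair_directions:
  fixes I :: "'i set" and J :: "'k set"
  assumes mp: "marked_pair I A a J B b R S" and c: "catches J (R a) B 0"
    and reachI: "\<And>i. i \<in> I \<Longrightarrow> (i, a) \<in> (edges I A)\<^sup>*"
    and reachJ: "\<And>k. k \<in> J \<Longrightarrow> (k, b) \<in> (edges J B)\<^sup>*"
  shows "\<exists>X Y. (\<forall>i\<in>I. \<forall>k\<in>J. R i k = 0 \<longrightarrow> 0 < tangent I J X R Y i k) \<and>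
               (\<forall>k\<in>J. \<forall>i\<in>I. S k i = 0 \<longrightarrow> 0 < tangent J I Y S X k i)"
proof -
  have fin: "finite I" "finite J" and marks: "a \<in> I" "b \<in> J"
    and A: "\<And>i j. i \<in> I \<Longrightarrow> j \<in> I \<Longrightarrow> A i j = (\<Sum>k\<in>J. R i k * S k j)"
    and B: "\<And>k l. k \<in> J \<Longrightarrow> l \<in> J \<Longrightarrow> B k l = (\<Sum>i\<in>I. S k i * R i l)"
    and R0: "\<And>i k. i \<in> I \<Longrightarrow> k \<in> J \<Longrightarrow> 0 \<le> R i k" and S0: "\<And>i k. i \<in> I \<Longrightarrow> k \<in> J \<Longrightarrow> 0 \<le> S k i"
    using mp by (auto simp: marked_pair_def)
  have A0: "\<And>i j. i \<in> I \<Longrightarrow> j \<in> I \<Longrightarrow> 0 \<le> A i j"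
    and B0: "\<And>i j. i \<in> J \<Longrightarrow> j \<in> J \<Longrightarrow> 0 \<le> B i j" and Aa: "0 < A a a"
    using marked_pair_nonneg[OF mp] marked_pair_nonneg[OF marked_pair_sym[OF mp]]
      marked_pair_loop[OF mp] by auto
  \<comment> \<open>The variables \<open>Inl (i, j)\<close> and \<open>Inr (k, l)\<close> are the entries of \<open>X\<close> and of \<open>Y\<close>.\<close>
  define V where "V = Inl ` (I \<times> I) \<union> Inr ` (J \<times> J)"
  define fR where "fR = (\<lambda>i k v. case v of
      Inl (p, j) \<Rightarrow> (if p = i then R j k else 0) | Inr (l, m) \<Rightarrow> (if m = k then - R i l else 0))"
  define fS where "fS = (\<lambda>k i v. case v of
      Inl (p, j) \<Rightarrow> (if j = i then - S k p else 0) | Inr (l, m) \<Rightarrow> (if l = k then S m i else 0))"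
  define CR where "CR = {(i, k) \<in> I \<times> J. R i k = 0}"
  define CS where "CS = {(k, i) \<in> J \<times> I. S k i = 0}"
  define C where "C = case_prod fR ` CR \<union> case_prod fS ` CS"
  have "finite CR" "finite CS"
    using fin by (auto simp: CR_def CS_def intro: finite_subset[of _ "I \<times> J"] finite_subset[of _ "J \<times> I"])
  then have "finite V" "finite C" using fin by (auto simp: V_def C_def)
  have sum_V: "(\<Sum>v\<in>V. g v) = (\<Sum>i\<in>I. \<Sum>j\<in>I. g (Inl (i, j))) + (\<Sum>k\<in>J. \<Sum>l\<in>J. g (Inr (k, l)))"
    for g :: "('i \<times> 'i) + ('k \<times> 'k) \<Rightarrow> real"
    using fin unfolding V_def
    by (subst sum.union_disjoint) (auto simp: sum.reindex sum.cartesian_product)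
  consider x where "\<And>f. f \<in> C \<Longrightarrow> 0 < (\<Sum>v\<in>V. f v * x v)" | g where "g \<in> conic_span C" "\<And>v. v \<in> V \<Longrightarrow> g v = 0"
    using gordan_alternative[OF \<open>finite V\<close> \<open>finite C\<close>] by blast
  then show ?thesis
  proof cases
    case (1 x)
    define X where "X = (\<lambda>i j. x (Inl (i, j)))"
    define Y where "Y = (\<lambda>k l. x (Inr (k, l)))"
    have if_mult: "(if Q then s else 0) * t = (if Q then s * t else 0)" for Q and s t :: real by simp
    have if_out: "(\<Sum>j\<in>T. if Q then h j else 0) = (if Q then (\<Sum>j\<in>T. h j) else 0)" for T Q and h :: "'z \<Rightarrow> real"
      by simp
    have "(\<Sum>v\<in>V. fR i k v * x v) = tangent I J X R Y i k" if "i \<in> I" "k \<in> J" for i k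
      unfolding sum_V using fin that
      by (simp add: fR_def tangent_def X_def Y_def if_mult if_out sum_negf, simp add: mult.commute)
    moreover have "(\<Sum>v\<in>V. fS k i v * x v) = tangent J I Y S X k i" if "i \<in> I" "k \<in> J" for i k
      unfolding sum_V using fin that
      by (simp add: fS_def tangent_def X_def Y_def if_mult if_out sum_negf, simp add: mult.commute)
    moreover have "0 < (\<Sum>v\<in>V. fR i k v * x v)" if "i \<in> I" "k \<in> J" "R i k = 0" for i k
      using 1[of "fR i k"] that by (force simp: C_def CR_def)
    moreover have "0 < (\<Sum>v\<in>V. fS k i v * x v)" if "i \<in> I" "k \<in> J" "S k i = 0" for i k
      using 1[of "fS k i"] that by (force simp: C_def CS_def)
    ultimately show ?thesis by (intro exI[of _ X] exI[of _ Y]) auto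
  next
    case (2 g)
    \<comment> \<open>A member of the cone is the functional whose coefficients are the entries of \<open>R Q - P S\<close> at the
      variables of \<open>X\<close> and of \<open>S P - Q R\<close> at those of \<open>Y\<close>, up to transposition.\<close>
    define ok where "ok = (\<lambda>Q P h. (\<forall>k\<in>J. \<forall>i\<in>I. 0 \<le> Q k i \<and> (Q k i \<noteq> 0 \<longrightarrow> R i k = 0)) \<and>
        (\<forall>k\<in>J. \<forall>i\<in>I. 0 \<le> P i k) \<and>
        (\<exists>k\<in>J. \<exists>i\<in>I. 0 < Q k i \<or> 0 < P i k) \<and>
        (\<forall>p\<in>I. \<forall>j\<in>I. h (Inl (p, j)) = (\<Sum>k\<in>J. R j k * Q k p) - (\<Sum>k\<in>J. P j k * S k p)) \<and>
        (\<forall>l\<in>J. \<forall>m\<in>J. h (Inr (l, m)) = (\<Sum>i\<in>I. S m i * P i l) - (\<Sum>i\<in>I. Q m i * R i l)))"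
    have "\<exists>Q P. ok Q P h" if "h \<in> conic_span C" for h
      using that
    proof (induction rule: conic_span.induct)
      case (gen f)
      have if_mult: "s * (if D then t else 0) = (if D then s * t else 0)"
        "(if D then t else 0) * s = (if D then t * s else 0)" for D and s t :: real by simp_all
      consider i k where "i \<in> I" "k \<in> J" "R i k = 0" "f = fR i k"
        | i k where "i \<in> I" "k \<in> J" "S k i = 0" "f = fS k i"
        using gen by (auto simp: C_def CR_def CS_def)
      then show ?case
      proof cases
        case (1 i k)
        then have "ok (\<lambda>l j. if l = k then if j = i then 1 else 0 else 0) (\<lambda>_ _. 0) f"
          using fin by (auto simp: ok_def fR_def if_mult)
        then show ?thesis by blast
      next
        case (2 i k)
        then have "ok (\<lambda>_ _. 0) (\<lambda>j l. if j = i then if l = k then 1 else 0 else 0) f"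
          using fin by (auto simp: ok_def fS_def if_mult)
        then show ?thesis by blast
      qed
    next
      case (add f h)
      then obtain Q P Q' P' where 1: "ok Q P f" and 2: "ok Q' P' h" by blast
      then obtain k i where ki: "k \<in> J" "i \<in> I" "0 < Q k i \<or> 0 < P i k" unfolding ok_def by blast
      moreover have "0 \<le> Q' k i" "0 \<le> P' i k" using 2 ki(1,2) unfolding ok_def by blast+
      ultimately have "\<exists>k\<in>J. \<exists>i\<in>I. 0 < Q k i + Q' k i \<or> 0 < P i k + P' i k"
        by (intro bexI[of _ k] bexI[of _ i]) auto
      moreover have "0 \<le> Q k i + Q' k i \<and> (Q k i + Q' k i \<noteq> 0 \<longrightarrow> R i k = 0) \<and> 0 \<le> P i k + P' i k"
        if "k \<in> J" "i \<in> I" for k i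
      proof -
        have "0 \<le> Q k i" "0 \<le> Q' k i" "0 \<le> P i k" "0 \<le> P' i k"
          "Q k i \<noteq> 0 \<longrightarrow> R i k = 0" "Q' k i \<noteq> 0 \<longrightarrow> R i k = 0"
          using 1 2 that unfolding ok_def by blast+
        then show ?thesis by auto
      qed
      ultimately have "ok (\<lambda>k i. Q k i + Q' k i) (\<lambda>i k. P i k + P' i k) (\<lambda>v. f v + h v)"
        using 1 2 unfolding ok_def by (simp add: distrib_left distrib_right sum.distrib)
      then show ?case by blast
    next
      case (scale f t)
      then obtain Q P where "ok Q P f" by blast
      then have "ok (\<lambda>k i. t * Q k i) (\<lambda>i k. t * P i k) (\<lambda>v. t * f v)"
        using scale(2) unfolding ok_def
        by (simp add: sum_distrib_left right_diff_distrib mult.left_commute[of _ t] mult.assoc zero_less_mult_iff)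
      then show ?case by blast
    qed
    then obtain Q P where "ok Q P g" using 2 by blast
    then have Q0: "\<And>k i. k \<in> J \<Longrightarrow> i \<in> I \<Longrightarrow> 0 \<le> Q k i"
      and QR0: "\<And>k i. k \<in> J \<Longrightarrow> i \<in> I \<Longrightarrow> Q k i \<noteq> 0 \<Longrightarrow> R i k = 0"
      and P0: "\<And>k i. k \<in> J \<Longrightarrow> i \<in> I \<Longrightarrow> 0 \<le> P i k"
      and ex: "\<exists>k\<in>J. \<exists>i\<in>I. 0 < Q k i \<or> 0 < P i k"
      and RQ: "\<And>p j. p \<in> I \<Longrightarrow> j \<in> I \<Longrightarrow> (\<Sum>k\<in>J. R j k * Q k p) = (\<Sum>k\<in>J. P j k * S k p)"
      and QR: "\<And>l m. l \<in> J \<Longrightarrow> m \<in> J \<Longrightarrow> (\<Sum>i\<in>I. S m i * P i l) = (\<Sum>i\<in>I. Q m i * R i l)"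
      using 2(2) unfolding ok_def V_def by auto
    have QA: "(\<Sum>i\<in>I. Q k i * A i j) = (\<Sum>l\<in>J. B k l * Q l j)" if kj: "k \<in> J" "j \<in> I" for k j
    proof -
      have "(\<Sum>i\<in>I. Q k i * A i j) = (\<Sum>i\<in>I. \<Sum>l\<in>J. Q k i * R i l * S l j)"
        using A kj by (simp add: sum_distrib_left mult.assoc)
      also have "\<dots> = (\<Sum>l\<in>J. (\<Sum>i\<in>I. Q k i * R i l) * S l j)"
        by (subst sum.swap) (simp add: sum_distrib_right)
      also have "\<dots> = (\<Sum>l\<in>J. (\<Sum>i\<in>I. S k i * P i l) * S l j)"
        using QR kj by simp
      also have "\<dots> = (\<Sum>i\<in>I. S k i * (\<Sum>l\<in>J. P i l * S l j))"
        by (simp add: sum_distrib_left sum_distrib_right mult.assoc sum.swap[of _ I J])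
      also have "\<dots> = (\<Sum>i\<in>I. S k i * (\<Sum>l\<in>J. R i l * Q l j))"
        using RQ kj by simp
      also have "\<dots> = (\<Sum>l\<in>J. (\<Sum>i\<in>I. S k i * R i l) * Q l j)"
        by (simp add: sum_distrib_left sum_distrib_right mult.assoc sum.swap[of _ I J])
      finally show ?thesis using B kj by simp
    qed
    have next_state: "\<exists>l\<in>J. 0 < B k l \<and> 0 < Q l a" if "k \<in> J" "0 < Q k a" for k
    proof (rule ccontr)
      assume "\<not> ?thesis"
      then have "B k l = 0 \<or> Q l a = 0" if "l \<in> J" for l
        using B0[OF \<open>k \<in> J\<close> that] Q0[OF that marks(1)] that by force
      then have "(\<Sum>l\<in>J. B k l * Q l a) = 0" by (intro sum.neutral) auto
      moreover have "0 < (\<Sum>i\<in>I. Q k i * A i a)"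
        using fin marks Q0 A0 Aa that by (intro sum_pos2[of I a]) auto
      ultimately show False using QA[of k a] that marks by simp
    qed
    have Qa: "Q k a = 0" if "k \<in> J" for k
    proof (rule ccontr)
      assume "Q k a \<noteq> 0"
      then have k: "k \<in> J \<and> 0 < Q k a" using Q0[OF that marks(1)] that by simp
      define nx where "nx = (\<lambda>k. SOME l. l \<in> J \<and> 0 < B k l \<and> 0 < Q l a)"
      have nx: "nx k \<in> J \<and> 0 < B k (nx k) \<and> 0 < Q (nx k) a" if "k \<in> J" "0 < Q k a" for k
      proof -
        have "\<exists>l. l \<in> J \<and> 0 < B k l \<and> 0 < Q l a" using next_state[OF that] by blast
        from someI_ex[OF this] show ?thesis unfolding nx_def .
      qed
      define p where "p = (\<lambda>i. (nx ^^ i) k)"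
      have p: "p i \<in> J \<and> 0 < Q (p i) a" for i
      proof (induction i)
        case 0
        show ?case using k by (simp add: p_def)
      next
        case (Suc i)
        then show ?case using nx[of "p i"] by (simp add: p_def)
      qed
      have "p i \<in> J \<and> 0 < B (p i) (p (Suc i))" for i
        using nx[of "p i"] p[of i] by (simp add: p_def)
      then obtain i where "p i \<in> hits J (R a) B 0" using c unfolding catches_def by blast
      then show False using QR0[of "p i" a] p[of i] marks by simp
    qed
    have Q: "Q k i = 0" if "k \<in> J" "i \<in> I" for k i
    proof -
      have "\<forall>k\<in>J. Q k i = 0"
        using reachI[OF that(2)]
      proof (induction rule: converse_rtrancl_induct)
        case base
        then show ?case using Qa by blast
      next
        case (step i j)
        then have e: "i \<in> I" "j \<in> I" "0 < A i j" by (auto simp: edges_def)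
        show ?case
        proof
          fix k assume k: "k \<in> J"
          have "(\<Sum>i\<in>I. Q k i * A i j) = 0" using QA[OF k e(2)] step.IH by simp
          then have "Q k i * A i j = 0"
            using sum_nonneg_eq_0_iff[OF fin(1), of "\<lambda>i. Q k i * A i j"] Q0 A0 k e by auto
          then show "Q k i = 0" using e by simp
        qed
      qed
      then show ?thesis using that by blast
    qed
    have "P i k = 0" if ki: "k \<in> J" "i \<in> I" for k i
    proof -
      obtain j where j: "j \<in> I" "0 < S k j"
        using marked_pair_row_nonzero[OF marked_pair_sym[OF mp] reachJ[OF ki(1)] ki(1)] by blast
      have "(\<Sum>k\<in>J. P i k * S k j) = 0" using RQ[of j i] Q j ki by simp
      then have "P i k * S k j = 0"
        using sum_nonneg_eq_0_iff[OF fin(2), of "\<lambda>k. P i k * S k j"] P0 S0 ki j by auto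
      then show ?thesis using j by simp
    qed
    then have False using ex Q by force
    then show ?thesis ..
  qed
qed

text \<open>
  The tangent of \<open>R S\<close> at \<open>X\<close> is the sum of the two products of a factor with the tangent of
  the other one; the terms in \<open>Y\<close> cancel.
\<close>

lemma tangent_product:
  fixes R :: "'i \<Rightarrow> 'k \<Rightarrow> real"
  assumes "finite I" "finite J" "i \<in> I" "j \<in> I"
    and A: "\<And>i j. i \<in> I \<Longrightarrow> j \<in> I \<Longrightarrow> A i j = (\<Sum>k\<in>J. R i k * S k j)"
  shows "tangent I I X A X i j =
    (\<Sum>k\<in>J. tangent I J X R Y i k * S k j) + (\<Sum>k\<in>J. R i k * tangent J I Y S X k j)"
proof -
  have "(\<Sum>p\<in>I. X i p * A p j) = (\<Sum>k\<in>J. \<Sum>p\<in>I. X i p * R p k * S k j)"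
    using assms by (subst sum.swap) (simp add: sum_distrib_left mult.assoc)
  moreover have "(\<Sum>p\<in>I. A i p * X p j) = (\<Sum>k\<in>J. \<Sum>p\<in>I. R i k * S k p * X p j)"
    using assms by (subst sum.swap) (simp add: sum_distrib_right mult.assoc)
  moreover have "(\<Sum>k\<in>J. (\<Sum>l\<in>J. R i l * Y l k) * S k j) = (\<Sum>k\<in>J. R i k * (\<Sum>l\<in>J. Y k l * S l j))"
    unfolding sum_distrib_left sum_distrib_right by (subst sum.swap) (simp add: mult.assoc)
  ultimately show ?thesis
    by (simp add: tangent_def left_diff_distrib right_diff_distrib sum_subtractf
        sum_distrib_left sum_distrib_right mult.assoc)
qed

text \<open>
  At a zero of \<open>A = R S\<close>, for each \<open>k\<close> one of \<open>R\<^sub>i\<^sub>k\<close> and \<open>S\<^sub>k\<^sub>j\<close> vanishes, so no summand of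
  \<open>tangent_product\<close> is negative; a nonzero entry in row \<open>i\<close> of \<open>R\<close> makes one of them positive.
\<close>

lemma tangent_product_positive:
  fixes R :: "'i \<Rightarrow> 'k \<Rightarrow> real"
  assumes mp: "marked_pair I A a J B b R S"
    and row: "\<exists>k\<in>J. 0 < R i k"
    and X: "\<And>k. k \<in> J \<Longrightarrow> R i k = 0 \<Longrightarrow> 0 < tangent I J X R Y i k"
    and Y: "\<And>k. k \<in> J \<Longrightarrow> S k j = 0 \<Longrightarrow> 0 < tangent J I Y S X k j"
    and ij: "i \<in> I" "j \<in> I" "A i j = 0"
  shows "0 < tangent I I X A X i j"
proof -
  have fin: "finite I" "finite J"
    and A: "\<And>i j. i \<in> I \<Longrightarrow> j \<in> I \<Longrightarrow> A i j = (\<Sum>k\<in>J. R i k * S k j)"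
    and nn: "\<And>k. k \<in> J \<Longrightarrow> 0 \<le> R i k" "\<And>k. k \<in> J \<Longrightarrow> 0 \<le> S k j"
    using mp ij by (auto simp: marked_pair_def)
  have zero: "R i k = 0 \<or> S k j = 0" if "k \<in> J" for k
    using marked_pair_edge_iff[OF mp ij(1,2)] ij(3) nn[OF that] that by force
  have t1: "0 \<le> tangent I J X R Y i k * S k j" if "k \<in> J" for k
    using zero[OF that] X[OF that] nn[OF that] by force
  have t2: "0 \<le> R i k * tangent J I Y S X k j" if "k \<in> J" for k
    using zero[OF that] Y[OF that] nn[OF that] by force
  obtain k where k: "k \<in> J" "0 < R i k" using row by blast
  then have "0 < R i k * tangent J I Y S X k j" using zero[OF k(1)] Y[OF k(1)] by simp
  then have "0 < (\<Sum>k\<in>J. R i k * tangent J I Y S X k j)"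
    using fin k t2 by (intro sum_pos2[of J k]) auto
  moreover have "0 \<le> (\<Sum>k\<in>J. tangent I J X R Y i k * S k j)" using t1 by (rule sum_nonneg)
  ultimately show ?thesis
    using tangent_product[OF fin ij(1,2) A, where X = X and Y = Y] by simp
qed

section \<open>Conjugation by matrices near the identity\<close>

lemma tendsto_det:
  fixes M :: "'x \<Rightarrow> real mat"
  assumes "\<And>x. M x \<in> carrier_mat n n" "L \<in> carrier_mat n n"
    and lim: "\<And>i j. i < n \<Longrightarrow> j < n \<Longrightarrow> ((\<lambda>x. M x $$ (i, j)) \<longlongrightarrow> L $$ (i, j)) F"
  shows "((\<lambda>x. det (M x)) \<longlongrightarrow> det L) F"
proof -
  have "p i < n" if "p permutes {0..<n}" "i < n" for p i
    using permutes_in_image[OF that(1), of i] that(2) by simp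
  then show ?thesis
    unfolding det_def'[OF assms(1)] det_def'[OF assms(2)]
    by (intro tendsto_sum tendsto_mult tendsto_const tendsto_prod lim) auto
qed

lemma tendsto_adj_mat:
  fixes M :: "'x \<Rightarrow> real mat"
  assumes M: "\<And>x. M x \<in> carrier_mat n n" and L: "L \<in> carrier_mat n n"
    and lim: "\<And>i j. i < n \<Longrightarrow> j < n \<Longrightarrow> ((\<lambda>x. M x $$ (i, j)) \<longlongrightarrow> L $$ (i, j)) F"
    and ij: "i < n" "j < n"
  shows "((\<lambda>x. adj_mat (M x) $$ (i, j)) \<longlongrightarrow> adj_mat L $$ (i, j)) F"
proof -
  have adj: "adj_mat T $$ (i, j) = (-1) ^ (j + i) * det (mat_delete T j i)" if "T \<in> carrier_mat n n" for T :: "real mat"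
    using that ij by (simp add: adj_mat_def cofactor_def)
  have "((\<lambda>x. det (mat_delete (M x) j i)) \<longlongrightarrow> det (mat_delete L j i)) F"
  proof (rule tendsto_det)
    show "mat_delete (M x) j i \<in> carrier_mat (n - 1) (n - 1)" for x
      using M[of x] by (auto simp: mat_delete_def)
    show "mat_delete L j i \<in> carrier_mat (n - 1) (n - 1)"
      using L by (auto simp: mat_delete_def)
    show "((\<lambda>x. mat_delete (M x) j i $$ (k, l)) \<longlongrightarrow> mat_delete L j i $$ (k, l)) F"
      if "k < n - 1" "l < n - 1" for k l
    proof -
      have "mat_delete T j i $$ (k, l) = T $$ (if k < j then k else Suc k, if l < i then l else Suc l)"
        if "T \<in> carrier_mat n n" for T :: "real mat"
        using that \<open>k < n - 1\<close> \<open>l < n - 1\<close> by (simp add: mat_delete_def)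
      then show ?thesis using that by (simp add: M L) (intro conjI impI lim; simp)
    qed
  qed
  then show ?thesis unfolding adj[OF M] adj[OF L] by (intro tendsto_intros)
qed

definition near_one :: "real \<Rightarrow> real mat \<Rightarrow> real mat" where
  "near_one e X = 1\<^sub>m (dim_row X) + e \<cdot>\<^sub>m X"

text \<open>By Cramer's rule, so that the limits below can be read off.\<close>

definition near_one_inv :: "real \<Rightarrow> real mat \<Rightarrow> real mat" where
  "near_one_inv e X = (1 / det (near_one e X)) \<cdot>\<^sub>m adj_mat (near_one e X)"

lemma near_one_carrier [simp]: "X \<in> carrier_mat n n \<Longrightarrow> near_one e X \<in> carrier_mat n n"
  by (auto simp: near_one_def)

lemma near_one_inv_carrier [simp]: "X \<in> carrier_mat n n \<Longrightarrow> near_one_inv e X \<in> carrier_mat n n"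
  using adj_mat(1)[OF near_one_carrier] by (simp add: near_one_inv_def)

lemma tendsto_near_one:
  assumes "X \<in> carrier_mat n n" "i < n" "j < n"
  shows "((\<lambda>e. near_one e X $$ (i, j)) \<longlongrightarrow> 1\<^sub>m n $$ (i, j)) (at_right 0)"
proof -
  have "((\<lambda>e. 1\<^sub>m n $$ (i, j) + e * X $$ (i, j)) \<longlongrightarrow> 1\<^sub>m n $$ (i, j) + 0 * X $$ (i, j)) (at_right 0)"
    by (intro tendsto_intros)
  then show ?thesis using assms by (simp add: near_one_def)
qed

lemma tendsto_det_near_one:
  assumes "X \<in> carrier_mat n n"
  shows "((\<lambda>e. det (near_one e X)) \<longlongrightarrow> 1) (at_right 0)"
  using tendsto_det[of "\<lambda>e. near_one e X" n "1\<^sub>m n"] tendsto_near_one assms by simp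

lemma adj_mat_one: "adj_mat (1\<^sub>m n :: real mat) = 1\<^sub>m n"
proof -
  have "(1 :: real) \<cdot>\<^sub>m 1\<^sub>m n = 1\<^sub>m n" by (intro eq_matI) auto
  then show ?thesis using adj_mat[of "1\<^sub>m n :: real mat" n] by simp
qed

lemma tendsto_near_one_inv:
  assumes "X \<in> carrier_mat n n" "i < n" "j < n"
  shows "((\<lambda>e. near_one_inv e X $$ (i, j)) \<longlongrightarrow> 1\<^sub>m n $$ (i, j)) (at_right 0)"
proof -
  have "((\<lambda>e. adj_mat (near_one e X) $$ (i, j)) \<longlongrightarrow> adj_mat (1\<^sub>m n) $$ (i, j)) (at_right 0)"
    using tendsto_adj_mat[of "\<lambda>e. near_one e X" n "1\<^sub>m n"] tendsto_near_one assms by simp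
  then have "((\<lambda>e. 1 / det (near_one e X) * adj_mat (near_one e X) $$ (i, j)) \<longlongrightarrow> 1 / 1 * 1\<^sub>m n $$ (i, j)) (at_right 0)"
    unfolding adj_mat_one using tendsto_det_near_one[OF assms(1)] by (intro tendsto_intros) auto
  moreover have "near_one_inv e X $$ (i, j) = 1 / det (near_one e X) * adj_mat (near_one e X) $$ (i, j)" for e
    using adj_mat(1)[OF near_one_carrier[OF assms(1), of e]] assms(2,3)
    by (simp add: near_one_inv_def)
  ultimately show ?thesis by simp
qed

lemma eventually_near_one_inverse:
  assumes X: "X \<in> carrier_mat n n"
  shows "\<forall>\<^sub>F e in at_right 0. near_one e X * near_one_inv e X = 1\<^sub>m n \<and> near_one_inv e X * near_one e X = 1\<^sub>m n"
proof -
  have "\<forall>\<^sub>F e in at_right 0. det (near_one e X) \<noteq> 0"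
    using tendsto_det_near_one[OF X] tendsto_imp_eventually_ne by force
  then show ?thesis
  proof eventually_elim
    case (elim e)
    note N = near_one_carrier[OF X, of e]
    show ?case
      using adj_mat[OF N] N elim
      by (auto simp: near_one_inv_def mult_smult_distrib[OF N adj_mat(1)[OF N]]
          mult_smult_assoc_mat[OF adj_mat(1)[OF N] N])
  qed
qed

lemma times_mat_entry:
  assumes "A \<in> carrier_mat n m" "B \<in> carrier_mat m p" "i < n" "j < p"
  shows "(A * B) $$ (i, j) = (\<Sum>k<m. A $$ (i, k) * B $$ (k, j))"
  using assms by (auto simp: scalar_prod_def lessThan_atLeast0 intro!: sum.cong)

text \<open>
  The identity behind this is \<open>(1 + e X) F (1 + e Y)\<^sup>-\<^sup>1 = F + e (X F - F Y) (1 + e Y)\<^sup>-\<^sup>1\<close>.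
\<close>

lemma eventually_perturbation_positive:
  assumes F: "F \<in> carrier_mat n m" and X: "X \<in> carrier_mat n n" and Y: "Y \<in> carrier_mat m m"
    and nonneg: "\<And>i k. i < n \<Longrightarrow> k < m \<Longrightarrow> 0 \<le> F $$ (i, k)"
    and dir: "\<And>i k. i < n \<Longrightarrow> k < m \<Longrightarrow> F $$ (i, k) = 0 \<Longrightarrow> 0 < (X * F - F * Y) $$ (i, k)"
  shows "\<forall>\<^sub>F e in at_right 0. positive_mat (near_one e X * F * near_one_inv e Y)"
proof -
  define D where "D = X * F - F * Y"
  have D: "D \<in> carrier_mat n m" using F X Y by (auto simp: D_def)
  define W where "W = (\<lambda>e. near_one_inv e Y)"
  have W: "W e \<in> carrier_mat m m" for e using Y by (simp add: W_def)
  have limDW: "((\<lambda>e. (D * W e) $$ (i, k)) \<longlongrightarrow> D $$ (i, k)) (at_right 0)" if "i < n" "k < m" for i k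
  proof -
    have "((\<lambda>e. \<Sum>l<m. D $$ (i, l) * W e $$ (l, k)) \<longlongrightarrow> (\<Sum>l<m. D $$ (i, l) * 1\<^sub>m m $$ (l, k))) (at_right 0)"
      using that Y unfolding W_def by (intro tendsto_intros tendsto_near_one_inv) auto
    also have "(\<Sum>l<m. D $$ (i, l) * 1\<^sub>m m $$ (l, k)) = D $$ (i, k)"
      using times_mat_entry[OF D one_carrier_mat that] D by simp
    finally show ?thesis using times_mat_entry[OF D W that] by simp
  qed
  have entry: "\<forall>\<^sub>F e in at_right 0. 0 < F $$ (i, k) + e * (D * W e) $$ (i, k)" if ik: "i < n" "k < m" for i k
  proof (cases "F $$ (i, k) = 0")
    case True
    then have "\<forall>\<^sub>F e in at_right 0. 0 < (D * W e) $$ (i, k)"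
      using dir[OF ik] limDW[OF ik] by (auto simp: D_def order_tendsto_iff)
    then show ?thesis
      using eventually_at_right_less[of "0::real"] by eventually_elim (simp add: True)
  next
    case False
    have "((\<lambda>e. F $$ (i, k) + e * (D * W e) $$ (i, k)) \<longlongrightarrow> F $$ (i, k) + 0 * D $$ (i, k)) (at_right 0)"
      using limDW[OF ik] by (intro tendsto_intros)
    then show ?thesis using nonneg[OF ik] False by (auto simp: order_tendsto_iff)
  qed
  have "\<forall>\<^sub>F e in at_right 0. \<forall>i\<in>{..<n}. \<forall>k\<in>{..<m}. 0 < F $$ (i, k) + e * (D * W e) $$ (i, k)"
    using entry by (intro eventually_ball_finite ballI) auto
  then show ?thesis
    using eventually_near_one_inverse[OF Y]
  proof eventually_elim
    case (elim e)
    have "near_one e X * F = F * near_one e Y + e \<cdot>\<^sub>m D"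
    proof (rule eq_matI)
      fix i k assume "i < dim_row (F * near_one e Y + e \<cdot>\<^sub>m D)" "k < dim_col (F * near_one e Y + e \<cdot>\<^sub>m D)"
      then have ik: "i < n" "k < m" using F D by auto
      have "(near_one e X * F) $$ (i, k) = F $$ (i, k) + e * (X * F) $$ (i, k)"
        using ik F X by (simp add: near_one_def add_mult_distrib_mat[of _ n n _ _ m] mult_smult_assoc_mat[of _ n n _ m])
      moreover have "(F * near_one e Y) $$ (i, k) = F $$ (i, k) + e * (F * Y) $$ (i, k)"
        using ik F Y by (simp add: near_one_def mult_add_distrib_mat[of _ n m _ m] mult_smult_distrib[of _ n m _ m])
      moreover have "(F * near_one e Y + e \<cdot>\<^sub>m D) $$ (i, k)
          = (F * near_one e Y) $$ (i, k) + e * ((X * F) $$ (i, k) - (F * Y) $$ (i, k))"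
        using ik F X Y near_one_carrier[OF Y, of e] by (auto simp: D_def)
      ultimately show "(near_one e X * F) $$ (i, k) = (F * near_one e Y + e \<cdot>\<^sub>m D) $$ (i, k)"
        by (simp add: algebra_simps)
    qed (use F X Y D in \<open>auto simp: near_one_def\<close>)
    also have "\<dots> * W e = F * near_one e Y * W e + e \<cdot>\<^sub>m D * W e"
      using F D W near_one_carrier[OF Y, of e] by (intro add_mult_distrib_mat[of _ n m _ _ m]) auto
    also have "F * near_one e Y * W e = F"
      using F elim near_one_carrier[OF Y, of e] W[of e] by (simp add: W_def assoc_mult_mat[of _ n m _ m _ m])
    also have "e \<cdot>\<^sub>m D * W e = e \<cdot>\<^sub>m (D * W e)" using D W by (rule mult_smult_assoc_mat)
    finally show ?case
      using elim F D W[of e] by (auto simp: positive_mat_def W_def)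
  qed
qed

definition positive_step :: "(real mat \<times> real mat) set" where
  "positive_step = {(A, B). square_mat A \<and> positive_mat A \<and> square_mat B \<and> positive_mat B \<and>
     elementary_sse {0..} A B}"

lemma elementary_sse_sym: "elementary_sse S A B \<Longrightarrow> elementary_sse S B A"
  unfolding elementary_sse_def by blast

lemma sym_positive_step: "sym positive_step"
  using elementary_sse_sym unfolding sym_def positive_step_def by blast

lemma positive_mat_elements: "positive_mat M \<Longrightarrow> elements_mat M \<subseteq> {0..}"
  by (fastforce simp: positive_mat_def)

lemma positive_mat_times:
  assumes "positive_mat U" "positive_mat V" "U \<in> carrier_mat n m" "V \<in> carrier_mat m p" "0 < m"
  shows "positive_mat (U * V)"
  unfolding positive_mat_def
proof (intro allI impI)
  fix i j assume "i < dim_row (U * V)" "j < dim_col (U * V)"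
  then have ij: "i < n" "j < p" using assms by auto
  then show "0 < (U * V) $$ (i, j)"
    unfolding times_mat_entry[OF assms(3,4) ij]
    using assms by (intro sum_pos) (auto simp: positive_mat_def)
qed

definition conj_near_one :: "real \<Rightarrow> real mat \<Rightarrow> real mat \<Rightarrow> real mat" where
  "conj_near_one e X A = near_one e X * A * near_one_inv e X"

text \<open>The inverses in the middle of the two products cancel.\<close>

lemma eventually_positive_step:
  assumes F: "F \<in> carrier_mat n m" and G: "G \<in> carrier_mat m n"
    and X: "X \<in> carrier_mat n n" and Y: "Y \<in> carrier_mat m m" and nm: "0 < n" "0 < m"
    and F0: "\<And>i k. i < n \<Longrightarrow> k < m \<Longrightarrow> 0 \<le> F $$ (i, k)"
    and G0: "\<And>i k. i < n \<Longrightarrow> k < m \<Longrightarrow> 0 \<le> G $$ (k, i)"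
    and dF: "\<And>i k. i < n \<Longrightarrow> k < m \<Longrightarrow> F $$ (i, k) = 0 \<Longrightarrow> 0 < (X * F - F * Y) $$ (i, k)"
    and dG: "\<And>i k. i < n \<Longrightarrow> k < m \<Longrightarrow> G $$ (k, i) = 0 \<Longrightarrow> 0 < (Y * G - G * X) $$ (k, i)"
  shows "\<forall>\<^sub>F e in at_right 0. (conj_near_one e X (F * G), conj_near_one e Y (G * F)) \<in> positive_step"
proof -
  have "\<forall>\<^sub>F e in at_right 0. positive_mat (near_one e X * F * near_one_inv e Y)"
    using assms by (intro eventually_perturbation_positive[of F n m]) auto
  moreover have "\<forall>\<^sub>F e in at_right 0. positive_mat (near_one e Y * G * near_one_inv e X)"
    using assms by (intro eventually_perturbation_positive[of G m n]) auto
  ultimately show ?thesis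
    using eventually_near_one_inverse[OF X] eventually_near_one_inverse[OF Y]
  proof eventually_elim
    case (elim e)
    define NX where "NX = near_one e X" define NY where "NY = near_one e Y"
    define WX where "WX = near_one_inv e X" define WY where "WY = near_one_inv e Y"
    have c: "NX \<in> carrier_mat n n" "WX \<in> carrier_mat n n" "NY \<in> carrier_mat m m" "WY \<in> carrier_mat m m"
      using X Y by (auto simp: NX_def NY_def WX_def WY_def)
    define U where "U = NX * F * WY"
    define V where "V = NY * G * WX"
    have UV: "U \<in> carrier_mat n m" "V \<in> carrier_mat m n" using c F G by (auto simp: U_def V_def)
    have pos: "positive_mat U" "positive_mat V"
      using elim by (auto simp: U_def V_def NX_def NY_def WX_def WY_def)
    have "U * V = NX * (F * (WY * (NY * (G * WX))))"
      unfolding U_def V_def using c F G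
      by (simp add: assoc_mult_mat[of _ n n _ m _ m] assoc_mult_mat[of _ n n _ m _ n]
          assoc_mult_mat[of _ n m _ m _ n] assoc_mult_mat[of _ m m _ n _ n])
    also have "WY * (NY * (G * WX)) = G * WX"
      using c G elim by (simp add: assoc_mult_mat[of _ m m _ m _ n, symmetric] NY_def WY_def)
    also have "NX * (F * (G * WX)) = NX * (F * G) * WX"
      using c F G by (simp add: assoc_mult_mat[of _ n m _ n _ n] assoc_mult_mat[of _ n n _ n _ n])
    finally have 1: "U * V = conj_near_one e X (F * G)" by (simp add: conj_near_one_def NX_def WX_def)
    have "V * U = NY * (G * (WX * (NX * (F * WY))))"
      unfolding U_def V_def using c F G
      by (simp add: assoc_mult_mat[of _ m m _ n _ n] assoc_mult_mat[of _ m m _ n _ m]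
          assoc_mult_mat[of _ m n _ n _ m] assoc_mult_mat[of _ n n _ m _ m])
    also have "WX * (NX * (F * WY)) = F * WY"
      using c F elim by (simp add: assoc_mult_mat[of _ n n _ n _ m, symmetric] NX_def WX_def)
    also have "NY * (G * (F * WY)) = NY * (G * F) * WY"
      using c F G by (simp add: assoc_mult_mat[of _ m n _ m _ m] assoc_mult_mat[of _ m m _ m _ m])
    finally have 2: "V * U = conj_near_one e Y (G * F)" by (simp add: conj_near_one_def NY_def WY_def)
    have "elementary_sse {0..} (U * V) (V * U)"
      unfolding elementary_sse_def using UV pos[THEN positive_mat_elements] by blast
    moreover have "positive_mat (U * V)" "positive_mat (V * U)"
      using positive_mat_times pos UV nm by blast+
    ultimately show ?case unfolding positive_step_def 1[symmetric] 2[symmetric] using UV by auto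
  qed
qed

definition direction :: "real mat \<Rightarrow> real mat \<Rightarrow> bool" where
  "direction A X \<longleftrightarrow> X \<in> carrier_mat (dim_row A) (dim_row A) \<and>
     (\<forall>i<dim_row A. \<forall>j<dim_row A. A $$ (i, j) = 0 \<longrightarrow> 0 < (X * A - A * X) $$ (i, j))"

definition positively_connected :: "real mat \<Rightarrow> real mat \<Rightarrow> real mat \<Rightarrow> real mat \<Rightarrow> bool" where
  "positively_connected A X B Y \<longleftrightarrow>
     (\<forall>\<^sub>F e in at_right 0. (conj_near_one e X A, conj_near_one e Y B) \<in> positive_step\<^sup>*)"

lemma positively_connected_sym:
  "positively_connected A X B Y \<Longrightarrow> positively_connected B Y A X"
  unfolding positively_connected_def
  by (elim eventually_mono) (use sym_rtrancl[OF sym_positive_step] in \<open>auto dest: symD\<close>)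

lemma positively_connected_trans:
  assumes "positively_connected A X B Y" "positively_connected B Y C Z"
  shows "positively_connected A X C Z"
  using assms unfolding positively_connected_def
  by eventually_elim (rule rtrancl_trans)

text \<open>
  The pair \<open>F = A\<close>, \<open>G = 1\<close> of \<open>eventually_positive_step\<close>; the zeros of \<open>1\<close> are off the diagonal,
  where the condition \<open>Y - X > 0\<close> appears.
\<close>

lemma positively_connected_below:
  assumes A: "A \<in> carrier_mat n n" and X: "X \<in> carrier_mat n n" and Y: "Y \<in> carrier_mat n n" and n: "0 < n"
    and A0: "\<And>i j. i < n \<Longrightarrow> j < n \<Longrightarrow> 0 \<le> A $$ (i, j)"
    and dA: "\<And>i j. i < n \<Longrightarrow> j < n \<Longrightarrow> A $$ (i, j) = 0 \<Longrightarrow> 0 < (X * A - A * Y) $$ (i, j)"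
    and XY: "\<And>i j. i < n \<Longrightarrow> j < n \<Longrightarrow> i \<noteq> j \<Longrightarrow> X $$ (i, j) < Y $$ (i, j)"
  shows "positively_connected A X A Y"
proof -
  have "\<forall>\<^sub>F e in at_right 0. (conj_near_one e X (A * 1\<^sub>m n), conj_near_one e Y (1\<^sub>m n * A)) \<in> positive_step"
  proof (rule eventually_positive_step[OF A one_carrier_mat X Y n n A0])
    show "0 < (Y * 1\<^sub>m n - 1\<^sub>m n * X) $$ (k, i)" if "i < n" "k < n" "(1\<^sub>m n :: real mat) $$ (k, i) = 0" for i k
      using that X Y XY[of k i] by (auto split: if_splits)
  qed (use dA in auto)
  then show ?thesis
    using A unfolding positively_connected_def by (elim eventually_mono) auto
qed

text \<open>
  The directions of \<open>A\<close> form an open convex set.  Nearby directions \<open>X\<close> and \<open>X'\<close> both lie below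
  \<open>X + h J\<close>, where \<open>J\<close> is the all-one matrix and \<open>h\<close> is small but exceeds their distance.  So the
  relation of being connected is open on the segment between two directions.
\<close>

lemma directions_positively_connected:
  assumes A: "A \<in> carrier_mat n n" and n: "0 < n"
    and A0: "\<And>i j. i < n \<Longrightarrow> j < n \<Longrightarrow> 0 \<le> A $$ (i, j)"
    and X: "direction A X" and Y: "direction A Y"
  shows "positively_connected A X A Y"
proof -
  have c: "X \<in> carrier_mat n n" "Y \<in> carrier_mat n n"
    and dX: "\<And>i j. i < n \<Longrightarrow> j < n \<Longrightarrow> A $$ (i, j) = 0 \<Longrightarrow> 0 < (X * A - A * X) $$ (i, j)"
    and dY: "\<And>i j. i < n \<Longrightarrow> j < n \<Longrightarrow> A $$ (i, j) = 0 \<Longrightarrow> 0 < (Y * A - A * Y) $$ (i, j)"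
    using X Y A by (auto simp: direction_def)
  \<comment> \<open>The segment from \<open>X\<close> to \<open>Y\<close>, shifted by \<open>h\<close> in every entry.\<close>
  define Z where "Z = (\<lambda>t h. mat n n (\<lambda>(i, j). (1 - t) * X $$ (i, j) + t * Y $$ (i, j) + h))"
  have Z: "Z t h \<in> carrier_mat n n" for t h by (simp add: Z_def)
  have Zij: "Z t h $$ (i, j) = (1 - t) * X $$ (i, j) + t * Y $$ (i, j) + h" if "i < n" "j < n" for t h i j
    using that by (simp add: Z_def)
  have lim: "((\<lambda>x. (Z (t x) 0 * A - A * Z (s x) (h x)) $$ (i, j)) \<longlongrightarrow> (Z u 0 * A - A * Z u 0) $$ (i, j)) F"
    if ij: "i < n" "j < n" and "(t \<longlongrightarrow> u) F" "(s \<longlongrightarrow> u) F" "(h \<longlongrightarrow> 0) F"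
    for i j u and t s h :: "real \<Rightarrow> real" and F
  proof -
    have e: "(Z t 0 * A - A * Z s h) $$ (i, j) =
        (\<Sum>k<n. ((1 - t) * X $$ (i, k) + t * Y $$ (i, k) + 0) * A $$ (k, j)) -
        (\<Sum>k<n. A $$ (i, k) * ((1 - s) * X $$ (k, j) + s * Y $$ (k, j) + h))" for t s h
      using ij A Z[of t 0] Z[of s h] times_mat_entry[OF Z A ij, of t 0] times_mat_entry[OF A Z ij, of s h]
      by (simp add: Zij)
    show ?thesis unfolding e by (intro tendsto_intros that)
  qed
  have dZ: "0 < (Z t 0 * A - A * Z t 0) $$ (i, j)"
    if ij: "i < n" "j < n" "A $$ (i, j) = 0" and t: "t \<in> {0..1}" for t i j
  proof -
    have "(Z t 0 * A - A * Z t 0) $$ (i, j)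
        = (1 - t) * (X * A - A * X) $$ (i, j) + t * (Y * A - A * Y) $$ (i, j)"
      using ij(1,2) A Z[of t 0] c times_mat_entry[OF Z A ij(1,2), of t 0] times_mat_entry[OF A Z ij(1,2), of t 0]
        times_mat_entry[OF c(1) A ij(1,2)] times_mat_entry[OF A c(1) ij(1,2)]
        times_mat_entry[OF c(2) A ij(1,2)] times_mat_entry[OF A c(2) ij(1,2)]
      by (simp add: Zij algebra_simps sum.distrib sum_subtractf sum_distrib_left)
    moreover have "0 < \<dots>"
    proof (cases "t = 0")
      case True
      then show ?thesis using dX[OF ij] by simp
    next
      case False
      then have "0 < t * (Y * A - A * Y) $$ (i, j)" using dY[OF ij] t by simp
      moreover have "0 \<le> (1 - t) * (X * A - A * X) $$ (i, j)" using dX[OF ij] t by simp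
      ultimately show ?thesis by linarith
    qed
    ultimately show ?thesis by simp
  qed
  have ev: "\<forall>\<^sub>F x in F. \<forall>i\<in>{..<n}. \<forall>j\<in>{..<n}. A $$ (i, j) = 0 \<longrightarrow> 0 < (Z (t x) 0 * A - A * Z (s x) (h x)) $$ (i, j)"
    if l: "(t \<longlongrightarrow> u) F" "(s \<longlongrightarrow> u) F" "(h \<longlongrightarrow> 0) F" and u: "u \<in> {0..1}"
    for u and t s h :: "real \<Rightarrow> real" and F
  proof (intro eventually_ball_finite ballI)
    fix i j assume "i \<in> {..<n}" "j \<in> {..<n}"
    then show "\<forall>\<^sub>F x in F. A $$ (i, j) = 0 \<longrightarrow> 0 < (Z (t x) 0 * A - A * Z (s x) (h x)) $$ (i, j)"
      using dZ[of i j u] lim[OF _ _ l, of i j] u by (cases "A $$ (i, j) = 0") (auto simp: order_tendsto_iff)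
  qed auto
  have local: "\<exists>T. openin (top_of_set {0..1}) T \<and> u \<in> T \<and> (\<forall>t\<in>T. positively_connected A (Z u 0) A (Z t 0))"
    if u: "u \<in> {0..1}" for u :: real
  proof -
    have "\<forall>\<^sub>F h in at_right (0::real). \<forall>i\<in>{..<n}. \<forall>j\<in>{..<n}. A $$ (i, j) = 0 \<longrightarrow>
            0 < (Z u 0 * A - A * Z u h) $$ (i, j)"
      by (rule ev[of "\<lambda>_. u" u _ "\<lambda>_. u" "\<lambda>h. h"]) (use u in \<open>auto intro: tendsto_intros\<close>)
    then have "\<forall>\<^sub>F h in at_right (0::real). 0 < h \<and> (\<forall>i\<in>{..<n}. \<forall>j\<in>{..<n}. A $$ (i, j) = 0 \<longrightarrow>
            0 < (Z u 0 * A - A * Z u h) $$ (i, j))"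
      using eventually_at_right_less[of "0::real"] by eventually_elim auto
    from eventually_happens'[OF trivial_limit_at_right_real this] obtain h where h: "0 < h"
      and dh: "\<And>i j. i < n \<Longrightarrow> j < n \<Longrightarrow> A $$ (i, j) = 0 \<Longrightarrow> 0 < (Z u 0 * A - A * Z u h) $$ (i, j)"
      by auto
    have up: "positively_connected A (Z u 0) A (Z u h)"
      using A Z n A0 dh h by (intro positively_connected_below[of A n]) (auto simp: Zij)
    have near: "\<forall>\<^sub>F t in nhds u. 0 < (Z t 0 * A - A * Z u h) $$ (i, j)"
      if ij: "i < n" "j < n" "A $$ (i, j) = 0" for i j
    proof -
      have "((\<lambda>t. (Z t 0 * A - A * Z u h) $$ (i, j)) \<longlongrightarrow> (Z u 0 * A - A * Z u h) $$ (i, j)) (nhds u)"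
      proof -
        have e: "(Z t 0 * A - A * Z u h) $$ (i, j) =
            (\<Sum>k<n. ((1 - t) * X $$ (i, k) + t * Y $$ (i, k) + 0) * A $$ (k, j)) - (A * Z u h) $$ (i, j)" for t
          using ij A Z[of t 0] Z[of u h] times_mat_entry[OF Z A ij(1,2), of t 0]
          by (simp add: Zij)
        show ?thesis unfolding e by (intro tendsto_intros filterlim_ident)
      qed
      then show ?thesis using dh[OF ij] by (auto simp: order_tendsto_iff)
    qed
    have "\<forall>\<^sub>F t in nhds u. \<forall>i\<in>{..<n}. \<forall>j\<in>{..<n}. A $$ (i, j) = 0 \<longrightarrow> 0 < (Z t 0 * A - A * Z u h) $$ (i, j)"
    proof (intro eventually_ball_finite ballI)
      fix i j assume "i \<in> {..<n}" "j \<in> {..<n}"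
      then show "\<forall>\<^sub>F t in nhds u. A $$ (i, j) = 0 \<longrightarrow> 0 < (Z t 0 * A - A * Z u h) $$ (i, j)"
        using near[of i j] by (cases "A $$ (i, j) = 0") auto
    qed auto
    moreover have "\<forall>\<^sub>F t in nhds u. \<forall>i\<in>{..<n}. \<forall>j\<in>{..<n}. Z t 0 $$ (i, j) < Z u h $$ (i, j)"
    proof (intro eventually_ball_finite ballI)
      fix i j assume "i \<in> {..<n}" "j \<in> {..<n}"
      then have ij: "i < n" "j < n" by auto
      have "((\<lambda>t. (1 - t) * X $$ (i, j) + t * Y $$ (i, j)) \<longlongrightarrow> (1 - u) * X $$ (i, j) + u * Y $$ (i, j)) (nhds u)"
        by (intro tendsto_intros filterlim_ident)
      then show "\<forall>\<^sub>F t in nhds u. Z t 0 $$ (i, j) < Z u h $$ (i, j)"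
        using h ij by (simp add: Zij order_tendsto_iff)
    qed auto
    ultimately have "\<forall>\<^sub>F t in nhds u. positively_connected A (Z t 0) A (Z u h)"
      by eventually_elim (use A Z n A0 in \<open>auto intro!: positively_connected_below[of A n]\<close>)
    then obtain T where T: "open T" "u \<in> T" "\<And>t. t \<in> T \<Longrightarrow> positively_connected A (Z t 0) A (Z u h)"
      unfolding eventually_nhds by blast
    then have "\<forall>t\<in>{0..1} \<inter> T. positively_connected A (Z u 0) A (Z t 0)"
      using up positively_connected_sym positively_connected_trans by blast
    moreover have "openin (top_of_set {0..1}) ({0..1} \<inter> T)" using T by (simp add: openin_open_Int)
    ultimately show ?thesis using T u by blast
  qed
  have "positively_connected A (Z 0 0) A (Z 1 0)"
  proof (rule connected_equivalence_relation[where S = "{0..1::real}" and R = "\<lambda>t s. positively_connected A (Z t 0) A (Z s 0)"])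
    show "connected {0..1::real}" by (rule connected_Icc)
    show "\<exists>T. openin (top_of_set {0..1}) T \<and> u \<in> T \<and> (\<forall>t\<in>T. positively_connected A (Z u 0) A (Z t 0))"
      if "u \<in> {0..1}" for u :: real using local[OF that] .
  qed (simp, simp, rule positively_connected_sym, assumption, rule positively_connected_trans)
  moreover have "Z 0 0 = X" "Z 1 0 = Y"
    using c by (auto intro!: eq_matI simp: Z_def)
  ultimately show ?thesis by simp
qed

section \<open>From systems to matrices\<close>

definition mat_of :: "nat set \<Rightarrow> nat set \<Rightarrow> (nat \<Rightarrow> nat \<Rightarrow> real) \<Rightarrow> real mat" where
  "mat_of I J F = mat (card I) (card J) (\<lambda>(i, j). F (sorted_list_of_set I ! i) (sorted_list_of_set J ! j))"

lemma mat_of_carrier [simp]: "mat_of I J F \<in> carrier_mat (card I) (card J)"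
  by (simp add: mat_of_def)

lemma enum_mem: "finite I \<Longrightarrow> i < card I \<Longrightarrow> sorted_list_of_set I ! i \<in> I"
  using nth_mem[of i "sorted_list_of_set I"] by simp

lemma sum_enum:
  assumes "finite J"
  shows "(\<Sum>l<card J. f (sorted_list_of_set J ! l)) = (\<Sum>j\<in>J. f j)"
  using assms by (intro sum.reindex_bij_betw bij_betw_nth) auto

lemma mat_of_times:
  assumes "finite J"
  shows "mat_of I J F * mat_of J K G = mat_of I K (\<lambda>i k. \<Sum>j\<in>J. F i j * G j k)"
proof (rule eq_matI)
  fix i k assume "i < dim_row (mat_of I K (\<lambda>i k. \<Sum>j\<in>J. F i j * G j k))"
    "k < dim_col (mat_of I K (\<lambda>i k. \<Sum>j\<in>J. F i j * G j k))"
  then have ik: "i < card I" "k < card K" by (auto simp: mat_of_def)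
  have "(mat_of I J F * mat_of J K G) $$ (i, k) = (\<Sum>l<card J. mat_of I J F $$ (i, l) * mat_of J K G $$ (l, k))"
    using times_mat_entry[OF mat_of_carrier mat_of_carrier ik] .
  also have "\<dots> = (\<Sum>l<card J. (\<lambda>j. F (sorted_list_of_set I ! i) j * G j (sorted_list_of_set K ! k)) (sorted_list_of_set J ! l))"
    using ik by (simp add: mat_of_def)
  also have "\<dots> = (\<Sum>j\<in>J. F (sorted_list_of_set I ! i) j * G j (sorted_list_of_set K ! k))"
    using assms by (rule sum_enum)
  finally show "(mat_of I J F * mat_of J K G) $$ (i, k) = mat_of I K (\<lambda>i k. \<Sum>j\<in>J. F i j * G j k) $$ (i, k)"
    using ik by (simp add: mat_of_def)
qed (auto simp: mat_of_def)

lemma mat_of_cong: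
  assumes "finite I" "finite J" "\<And>i j. i \<in> I \<Longrightarrow> j \<in> J \<Longrightarrow> F i j = G i j"
  shows "mat_of I J F = mat_of I J G"
  using assms(3)[OF enum_mem[OF assms(1)] enum_mem[OF assms(2)]]
  by (auto simp: mat_of_def intro!: eq_matI)

lemma mat_of_tangent:
  assumes "finite I" "finite J" "i < card I" "k < card J"
  shows "(mat_of I I X * mat_of I J F - mat_of I J F * mat_of J J Y) $$ (i, k)
    = tangent I J X F Y (sorted_list_of_set I ! i) (sorted_list_of_set J ! k)"
  using assms by (simp add: mat_of_times) (simp add: mat_of_def tangent_def)

lemma mat_of_self:
  assumes "A \<in> carrier_mat n n"
  shows "mat_of {..<n} {..<n} (\<lambda>i j. A $$ (i, j)) = A"
proof -
  have "sorted_list_of_set {..<n} = [0..<n]" by (simp add: lessThan_atLeast0)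
  then show ?thesis using assms by (auto simp: mat_of_def intro!: eq_matI)
qed

definition component_mat :: "system \<Rightarrow> real mat" where
  "component_mat s = (case component_system s of (I, A, a) \<Rightarrow> mat_of I I A)"

definition nonneg_square :: "real mat \<Rightarrow> bool" where
  "nonneg_square M \<longleftrightarrow> square_mat M \<and> 0 < dim_row M \<and> (\<forall>i<dim_row M. \<forall>j<dim_row M. 0 \<le> M $$ (i, j))"

lemma nonneg_square_mat_of:
  assumes mp: "marked_pair I A a J B b R S"
  shows "nonneg_square (mat_of I I A)"
proof -
  have "finite I" "card I \<noteq> 0" using mp by (auto simp: marked_pair_def)
  then show ?thesis
    using marked_pair_nonneg[OF mp] enum_mem[of I] by (auto simp: nonneg_square_def mat_of_def)
qed

lemma direction_mat_of:
  assumes mp: "marked_pair I A a J B b R S"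
    and reach: "\<And>i. i \<in> I \<Longrightarrow> (i, a) \<in> (edges I A)\<^sup>*"
    and X: "\<And>i k. i \<in> I \<Longrightarrow> k \<in> J \<Longrightarrow> R i k = 0 \<Longrightarrow> 0 < tangent I J X R Y i k"
    and Y: "\<And>i k. i \<in> I \<Longrightarrow> k \<in> J \<Longrightarrow> S k i = 0 \<Longrightarrow> 0 < tangent J I Y S X k i"
  shows "direction (mat_of I I A) (mat_of I I X)"
proof -
  have fin: "finite I" using mp by (simp add: marked_pair_def)
  have pos: "0 < tangent I I X A X i j" if "i \<in> I" "j \<in> I" "A i j = 0" for i j
    using that X Y marked_pair_row_nonzero[OF mp reach[OF that(1)] that(1)]
    by (intro tangent_product_positive[OF mp]) auto
  have dim: "dim_row (mat_of I I A) = card I" by (simp add: mat_of_def)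
  have "0 < (mat_of I I X * mat_of I I A - mat_of I I A * mat_of I I X) $$ (i, j)"
    if "i < card I" "j < card I" "mat_of I I A $$ (i, j) = 0" for i j
    using pos[of "sorted_list_of_set I ! i" "sorted_list_of_set I ! j"] enum_mem[OF fin] that
    by (simp add: mat_of_tangent[OF fin fin that(1,2)]) (simp add: mat_of_def)
  then show ?thesis unfolding direction_def dim by simp
qed

text \<open>
  With delay \<open>0\<close> the criterion for directions passes to the strong components of the marks, on which
  every state reaches the mark.
\<close>

lemma link_0_directions:
  assumes "(s, t) \<in> link 0"
  shows "nonneg_square (component_mat s) \<and> nonneg_square (component_mat t) \<and>
    (\<exists>X Y. direction (component_mat s) X \<and> direction (component_mat t) Y \<and>
       positively_connected (component_mat s) X (component_mat t) Y)"
proof -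
  obtain I' A a J' B b where st: "s = (I', A, a)" "t = (J', B, b)" by (metis prod_cases3)
  then obtain R S where mp': "marked_pair I' A a J' B b R S" and c': "catches J' (R a) B 0"
    using assms unfolding link_def by auto
  define I where "I = mark_component I' A a"
  define J where "J = mark_component J' B b"
  have eq: "component_mat s = mat_of I I A" "component_mat t = mat_of J J B"
    by (auto simp: component_mat_def component_system_def st I_def J_def)
  have mp: "marked_pair I A a J B b R S" unfolding I_def J_def by (rule marked_pair_component[OF mp'])
  have reach: "\<And>i. i \<in> I \<Longrightarrow> (i, a) \<in> (edges I A)\<^sup>*" "\<And>k. k \<in> J \<Longrightarrow> (k, b) \<in> (edges J B)\<^sup>*"
    unfolding I_def J_def by (rule mark_component_reach(2), assumption)+
  have c: "catches J (R a) B 0"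
    using c' unfolding catches_def J_def by (auto simp: mark_component_def)
  have fin: "finite I" "finite J" and
    AB: "\<And>i j. i \<in> I \<Longrightarrow> j \<in> I \<Longrightarrow> A i j = (\<Sum>k\<in>J. R i k * S k j)"
    "\<And>k l. k \<in> J \<Longrightarrow> l \<in> J \<Longrightarrow> B k l = (\<Sum>i\<in>I. S k i * R i l)"
    and nn: "\<And>i k. i \<in> I \<Longrightarrow> k \<in> J \<Longrightarrow> 0 \<le> R i k" "\<And>i k. i \<in> I \<Longrightarrow> k \<in> J \<Longrightarrow> 0 \<le> S k i"
    using mp by (auto simp: marked_pair_def)
  obtain X Y where XY: "\<And>i k. i \<in> I \<Longrightarrow> k \<in> J \<Longrightarrow> R i k = 0 \<Longrightarrow> 0 < tangent I J X R Y i k"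
    "\<And>i k. i \<in> I \<Longrightarrow> k \<in> J \<Longrightarrow> S k i = 0 \<Longrightarrow> 0 < tangent J I Y S X k i"
    using marked_pair_directions[OF mp c reach] by blast
  have prods: "mat_of I J R * mat_of J I S = mat_of I I A" "mat_of J I S * mat_of I J R = mat_of J J B"
    unfolding mat_of_times[OF fin(1)] mat_of_times[OF fin(2)]
    using AB fin by (auto intro!: mat_of_cong)
  have entries: "mat_of I J R $$ (i, k) = R (sorted_list_of_set I ! i) (sorted_list_of_set J ! k)"
    "mat_of J I S $$ (k, i) = S (sorted_list_of_set J ! k) (sorted_list_of_set I ! i)"
    if "i < card I" "k < card J" for i k using that by (simp_all add: mat_of_def)
  have "\<forall>\<^sub>F e in at_right 0. (conj_near_one e (mat_of I I X) (mat_of I J R * mat_of J I S),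
      conj_near_one e (mat_of J J Y) (mat_of J I S * mat_of I J R)) \<in> positive_step"
  proof (rule eventually_positive_step[OF mat_of_carrier mat_of_carrier mat_of_carrier mat_of_carrier])
    show "0 < card I" "0 < card J" using mp fin by (auto simp: marked_pair_def card_gt_0_iff)
    fix i k assume ik: "i < card I" "k < card J"
    note mem = enum_mem[OF fin(1) ik(1)] enum_mem[OF fin(2) ik(2)]
    show "0 \<le> mat_of I J R $$ (i, k)" "0 \<le> mat_of J I S $$ (k, i)"
      unfolding entries[OF ik] using nn[OF mem] by auto
    show "0 < (mat_of I I X * mat_of I J R - mat_of I J R * mat_of J J Y) $$ (i, k)"
      if "mat_of I J R $$ (i, k) = 0"
      using XY(1)[OF mem] that unfolding entries[OF ik] mat_of_tangent[OF fin ik] .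
    show "0 < (mat_of J J Y * mat_of J I S - mat_of J I S * mat_of I I X) $$ (k, i)"
      if "mat_of J I S $$ (k, i) = 0"
      using XY(2)[OF mem] that unfolding entries[OF ik] mat_of_tangent[OF fin(2,1) ik(2,1)] .
  qed
  then have "positively_connected (mat_of I I A) (mat_of I I X) (mat_of J J B) (mat_of J J Y)"
    unfolding prods positively_connected_def by (elim eventually_mono) auto
  moreover have "direction (mat_of I I A) (mat_of I I X)"
    using direction_mat_of[OF mp reach(1)] XY by blast
  moreover have "direction (mat_of J J B) (mat_of J J Y)"
    using direction_mat_of[OF marked_pair_sym[OF mp] reach(2)] XY by blast
  ultimately show ?thesis
    unfolding eq using nonneg_square_mat_of[OF mp] nonneg_square_mat_of[OF marked_pair_sym[OF mp]] by blast
qed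

lemma nonneg_square_directions_connected:
  assumes "nonneg_square A" "direction A X" "direction A Y"
  shows "positively_connected A X A Y"
proof (rule directions_positively_connected)
  show "A \<in> carrier_mat (dim_row A) (dim_row A)" using assms(1) by (auto simp: nonneg_square_def)
qed (use assms in \<open>auto simp: nonneg_square_def\<close>)

lemma linked_0_positively_connected:
  assumes "(s, t) \<in> linked 0" and s: "nonneg_square (component_mat s)"
    and X: "direction (component_mat s) X" and "direction (component_mat t) Y"
  shows "positively_connected (component_mat s) X (component_mat t) Y"
  using assms(1,4) unfolding linked_def
proof (induction arbitrary: Y rule: rtrancl_induct)
  case base
  then show ?case using nonneg_square_directions_connected s X by blast
next
  case (step t u)
  then have u: "nonneg_square (component_mat u)"
    and "\<exists>X' Y'. direction (component_mat t) X' \<and> direction (component_mat u) Y' \<and>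
       positively_connected (component_mat t) X' (component_mat u) Y'"
    using link_0_directions positively_connected_sym by blast+
  then obtain X' Y' where "direction (component_mat t) X'" and Y': "direction (component_mat u) Y'"
    and c: "positively_connected (component_mat t) X' (component_mat u) Y'" by blast
  then have "positively_connected (component_mat s) X (component_mat t) X'" using step.IH by blast
  moreover note c
  moreover have "positively_connected (component_mat u) Y' (component_mat u) Y"
    using nonneg_square_directions_connected[OF u Y' step.prems] .
  ultimately show ?case by (blast intro: positively_connected_trans)
qed

definition mat_system :: "real mat \<Rightarrow> nat \<Rightarrow> system" where
  "mat_system M a = ({..<dim_row M}, \<lambda>i j. M $$ (i, j), a)"

lemma elementary_sse_marked_pair:
  assumes "elementary_sse {0..} A B" "a < dim_row A" "0 < A $$ (a, a)"
  shows "\<exists>b R S. marked_pair {..<dim_row A} (\<lambda>i j. A $$ (i, j)) a {..<dim_row B} (\<lambda>i j. B $$ (i, j)) b R S"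
proof -
  obtain m n U V where UV: "U \<in> carrier_mat m n" "V \<in> carrier_mat n m"
    "elements_mat U \<subseteq> {0..}" "elements_mat V \<subseteq> {0..}" "A = U * V" "B = V * U"
    using assms(1) unfolding elementary_sse_def by blast
  have U0: "0 \<le> U $$ (i, k)" and V0: "0 \<le> V $$ (k, i)" if "i < m" "k < n" for i k
    using UV elements_matI[OF UV(1) that refl] elements_matI[OF UV(2) that(2,1) refl] by auto
  have dims: "dim_row A = m" "dim_row B = n" using UV by auto
  have A: "A $$ (i, j) = (\<Sum>k<n. U $$ (i, k) * V $$ (k, j))" if "i < m" "j < m" for i j
    using times_mat_entry[OF UV(1,2) that] UV(5) by simp
  have B: "B $$ (k, l) = (\<Sum>i<m. V $$ (k, i) * U $$ (i, l))" if "k < n" "l < n" for k l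
    using times_mat_entry[OF UV(2,1) that] UV(6) by simp
  have "\<exists>b<n. U $$ (a, b) * V $$ (b, a) \<noteq> 0"
  proof (rule ccontr)
    assume "\<not> ?thesis"
    then have "(\<Sum>k<n. U $$ (a, k) * V $$ (k, a)) = 0" by (intro sum.neutral) auto
    then have "A $$ (a, a) = 0" using A[of a a] assms(2) dims by simp
    then show False using assms(3) by simp
  qed
  then obtain b where b: "b < n" "U $$ (a, b) * V $$ (b, a) \<noteq> 0" by blast
  have "0 \<le> U $$ (a, b)" "0 \<le> V $$ (b, a)" using U0 V0 b assms(2) dims by auto
  then have "0 < U $$ (a, b)" "0 < V $$ (b, a)" using b by (auto simp: less_le)
  then have "marked_pair {..<m} (\<lambda>i j. A $$ (i, j)) a {..<n} (\<lambda>i j. B $$ (i, j)) b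
      (\<lambda>i j. U $$ (i, j)) (\<lambda>i j. V $$ (i, j))"
    unfolding marked_pair_def using A B U0 V0 b assms(2) dims by auto
  then show ?thesis unfolding dims by blast
qed

text \<open>A positive diagonal entry propagates along a chain and supplies the marks.\<close>

lemma chain_linked:
  assumes "\<forall>i<l. elementary_sse {0..} (M i) (M (Suc i))"
    and "a < dim_row (M 0)" "0 < M 0 $$ (a, a)" and "k \<le> l"
  shows "\<exists>b<dim_row (M k). 0 < M k $$ (b, b) \<and>
    (\<exists>q. (component_system (mat_system (M 0) a), component_system (mat_system (M k) b)) \<in> linked q)"
  using assms(4)
proof (induction k)
  case 0
  show ?case using assms(2,3) by (intro exI[of _ a] conjI exI[of _ 0]) (simp_all add: linked_def)
next
  case (Suc k)
  from Suc.IH[OF Suc_leD[OF Suc.prems]] obtain b q where b: "b < dim_row (M k)" "0 < M k $$ (b, b)"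
    and q: "(component_system (mat_system (M 0) a), component_system (mat_system (M k) b)) \<in> linked q"
    by blast
  have "elementary_sse {0..} (M k) (M (Suc k))" using assms(1) Suc.prems by simp
  from elementary_sse_marked_pair[OF this b] obtain c R S
    where mp: "marked_pair {..<dim_row (M k)} (\<lambda>i j. M k $$ (i, j)) b
      {..<dim_row (M (Suc k))} (\<lambda>i j. M (Suc k) $$ (i, j)) c R S" by blast
  obtain q' where q': "(component_system (mat_system (M k) b), component_system (mat_system (M (Suc k)) c)) \<in> linked q'"
    using linked_component_systems[OF mp] unfolding mat_system_def by blast
  have "(component_system (mat_system (M 0) a), component_system (mat_system (M (Suc k)) c)) \<in> linked (max q q')"
  proof (rule linked_trans)
    show "(component_system (mat_system (M 0) a), component_system (mat_system (M k) b)) \<in> linked (max q q')"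
      by (rule subsetD[OF linked_mono q]) simp
    show "(component_system (mat_system (M k) b), component_system (mat_system (M (Suc k)) c)) \<in> linked (max q q')"
      by (rule subsetD[OF linked_mono q']) simp
  qed
  moreover have "c < dim_row (M (Suc k))" "0 < M (Suc k) $$ (c, c)"
    using mp marked_pair_loop[OF marked_pair_sym[OF mp]] by (auto simp: marked_pair_def)
  ultimately show ?case by blast
qed

lemma component_positive_mat:
  assumes "square_mat A" "positive_mat A" "a < dim_row A"
  shows "component_system (mat_system A a) = mat_system A a" and "component_mat (mat_system A a) = A"
    and "nonneg_square A" and "direction A (0\<^sub>m (dim_row A) (dim_row A))"
    and "conj_near_one e (0\<^sub>m (dim_row A) (dim_row A)) A = A"
proof -
  let ?n = "dim_row A"
  have c: "A \<in> carrier_mat ?n ?n" and pos: "\<And>i j. i < ?n \<Longrightarrow> j < ?n \<Longrightarrow> 0 < A $$ (i, j)"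
    using assms by (auto simp: positive_mat_def)
  show comp: "component_system (mat_system A a) = mat_system A a"
    using mark_component_positive[of a "{..<?n}" "\<lambda>i j. A $$ (i, j)"] pos assms(3)
    by (simp add: component_system_def mat_system_def)
  show "component_mat (mat_system A a) = A"
    unfolding component_mat_def comp using mat_of_self[OF c] by (simp add: mat_system_def)
  show "nonneg_square A"
    unfolding nonneg_square_def
  proof (intro conjI allI impI)
    show "0 \<le> A $$ (i, j)" if "i < ?n" "j < ?n" for i j using pos[OF that] by (rule less_imp_le)
  qed (rule assms(1), rule le_less_trans[OF le0 assms(3)])
  show "direction A (0\<^sub>m ?n ?n)"
    unfolding direction_def
  proof (intro conjI allI impI)
    fix i j assume "i < ?n" "j < ?n" "A $$ (i, j) = 0"
    then show "0 < (0\<^sub>m ?n ?n * A - A * 0\<^sub>m ?n ?n) $$ (i, j)" using pos[of i j] by linarith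
  qed simp
  have one: "near_one e (0\<^sub>m ?n ?n) = 1\<^sub>m ?n"
    unfolding near_one_def by (rule eq_matI) simp_all
  have "(1 / 1 :: real) \<cdot>\<^sub>m 1\<^sub>m ?n = 1\<^sub>m ?n" by (rule eq_matI) simp_all
  then have inv: "near_one_inv e (0\<^sub>m ?n ?n) = 1\<^sub>m ?n"
    unfolding near_one_inv_def one adj_mat_one det_one .
  show "conj_near_one e (0\<^sub>m ?n ?n) A = A"
    unfolding conj_near_one_def one inv left_mult_one_mat[OF c] by (rule right_mult_one_mat[OF c])
qed

lemma positive_chain_if_loop:
  assumes "square_mat A" "square_mat B" "positive_mat A" "positive_mat B"
    and chain: "\<forall>i<l. elementary_sse {0..} (M i) (M (Suc i))" and ends: "M 0 = A" "M l = B"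
    and A: "0 < dim_row A"
  shows "(A, B) \<in> positive_step\<^sup>*"
proof -
  have pos: "\<And>i j. i < dim_row A \<Longrightarrow> j < dim_row A \<Longrightarrow> 0 < A $$ (i, j)"
    "\<And>i j. i < dim_row B \<Longrightarrow> j < dim_row B \<Longrightarrow> 0 < B $$ (i, j)"
    using assms(1-4) by (auto simp: positive_mat_def)
  from chain_linked[OF chain, of 0 l, unfolded ends, OF A pos(1)[OF A A] order_refl]
  obtain b q where b: "b < dim_row B"
    and q: "(component_system (mat_system A 0), component_system (mat_system B b)) \<in> linked q"
    by blast
  note comp = component_positive_mat[OF assms(1,3) A] component_positive_mat[OF assms(2,4) b]
  have "(mat_system A 0, mat_system B b) \<in> linked q" using q unfolding comp(1,6) .
  then have "(mat_system A 0, mat_system B b) \<in> linked 0"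
    unfolding mat_system_def
    by (rule linked_0_if_linked) (use A b in \<open>simp_all add: pos\<close>)
  then have "positively_connected A (0\<^sub>m (dim_row A) (dim_row A)) B (0\<^sub>m (dim_row B) (dim_row B))"
    using linked_0_positively_connected[of "mat_system A 0" "mat_system B b"] comp(3,4,9)
    unfolding comp(2,7) by blast
  then have "\<forall>\<^sub>F e::real in at_right 0. (A, B) \<in> positive_step\<^sup>*"
    unfolding positively_connected_def comp(5,10) .
  then show ?thesis by simp
qed

theorem theorem8p1:
  fixes A B :: "real mat"
  assumes "square_mat A" and "square_mat B"
    and "positive_mat A" and "positive_mat B"
    and "strong_shift_equivalent {0..} A B"
  shows "\<exists>(l::nat) (M :: nat \<Rightarrow> real mat). M 0 = A \<and> M l = B \<and>
           (\<forall>i\<le>l. square_mat (M i) \<and> positive_mat (M i)) \<and>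
           (\<forall>i<l. elementary_sse {0..} (M i) (M (Suc i)))"
proof -
  obtain l N where N: "N 0 = A \<and> N l = B \<and> (\<forall>i\<le>l. square_mat (N i) \<and> elements_mat (N i) \<subseteq> {0..}) \<and>
      (\<forall>i<l. elementary_sse {0..} (N i) (N (Suc i)))"
    using assms(5) unfolding strong_shift_equivalent_def by (elim exE)
  then have ends: "N 0 = A" "N l = B" and chain: "\<forall>i<l. elementary_sse {0..} (N i) (N (Suc i))"
    by blast+
  have "(A, B) \<in> positive_step\<^sup>*"
  proof (cases "dim_row A = 0")
    case False
    then show ?thesis using positive_chain_if_loop[OF assms(1-4) chain ends] by simp
  next
    case True
    \<comment> \<open>Positive diagonal entries cannot appear along a chain, so \<open>B\<close> is empty as well.\<close>
    have no_loop: "\<not> (\<exists>a<dim_row (N k). 0 < N k $$ (a, a))" if "k \<le> l" for k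
      using that
    proof (induction k)
      case 0
      show ?case unfolding ends(1) True by simp
    next
      case (Suc k)
      have "elementary_sse {0..} (N k) (N (Suc k))" using chain Suc.prems by simp
      then have reversed: "elementary_sse {0..} (N (Suc k)) (N k)" by (rule elementary_sse_sym)
      show ?case
      proof
        assume "\<exists>a<dim_row (N (Suc k)). 0 < N (Suc k) $$ (a, a)"
        then obtain a where a: "a < dim_row (N (Suc k))" "0 < N (Suc k) $$ (a, a)" by blast
        from elementary_sse_marked_pair[OF reversed a] obtain b R S where mp: "marked_pair {..<dim_row (N (Suc k))} (\<lambda>i j. N (Suc k) $$ (i, j)) a
            {..<dim_row (N k)} (\<lambda>i j. N k $$ (i, j)) b R S"
          by blast
        have "b < dim_row (N k)" using mp by (simp add: marked_pair_def)
        moreover have "0 < N k $$ (b, b)" using marked_pair_loop[OF marked_pair_sym[OF mp]] .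
        ultimately show False using Suc.IH[OF Suc_leD[OF Suc.prems]] by blast
      qed
    qed
    have col: "dim_col A = dim_row A" "dim_col B = dim_row B" using assms(1,2) by simp_all
    have "dim_row B = 0"
    proof (rule ccontr)
      assume "dim_row B \<noteq> 0"
      then have "0 < dim_row B" "0 < B $$ (0, 0)" using assms(4) col(2) by (simp_all add: positive_mat_def)
      then show False using no_loop[OF order_refl] unfolding ends(2) by blast
    qed
    then have "A = B" using True col by (intro eq_matI) simp_all
    then show ?thesis by simp
  qed
  then obtain n where "(A, B) \<in> positive_step ^^ n" using rtrancl_imp_relpow by blast
  then obtain f where "f 0 = A \<and> f n = B \<and> (\<forall>i<n. (f i, f (Suc i)) \<in> positive_step)"
    unfolding relpow_fun_conv ..
  then have f: "f 0 = A" "f n = B" "\<And>i. i < n \<Longrightarrow> (f i, f (Suc i)) \<in> positive_step"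
    by blast+
  show ?thesis
  proof (rule exI[of _ n], rule exI[of _ f], intro conjI allI impI)
    show "f 0 = A" "f n = B" by (fact f)+
    show "elementary_sse {0..} (f i) (f (Suc i))" if "i < n" for i
      using f(3)[OF that] by (simp add: positive_step_def)
    fix i assume "i \<le> n"
    then consider "i = n" | "i < n" by linarith
    then have "square_mat (f i) \<and> positive_mat (f i)"
    proof cases
      case 1
      show ?thesis unfolding 1 f(2) using assms(2,4) ..
    next
      case 2
      from f(3)[OF 2] show ?thesis by (simp add: positive_step_def)
    qed
    then show "square_mat (f i)" "positive_mat (f i)" by blast+
  qed
qed

end
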